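(* Let $f:\mathbb{R}^{m\times n}\to\mathbb{R}$ be twice continuously differentiable and $\bar f=f\circ\phi$. Let $(X,G)\in\mathcal{M}_h$ and $(\eta,\zeta)\in\mathrm{T}_{(X,G)}\mathcal{M}_h$ have representations $(H,V)$ and $(K,V_p)$, respectively. Then the Riemannian Hessian $\nabla^2_{\mathcal{M}_h}\bar f(X,G)[\eta,\zeta]$ is represented by $$\bar K=\nabla^2_{\mathcal{H}}f(X)[\eta]V+\mathcal{P}_{\mathrm{T}_H\mathcal{H}^r}\big(W_{H,\omega}\nabla f(X)V_p\big),$$ $$\bar V_p=G\Big(-V_p\big[\mathcal{P}_{\mathrm{N}_H\mathcal{H}^r}(\nabla f(X)V)\big]^\top H+(\nabla^2f(X)[\eta])^\top H+\nabla f(X)^\top W_{H,\omega}K\Big)M_{H,\omega}^{-1},$$ where $W_{H,\omega}=I-HM_{H,\omega}^{-1}H^\top$; that is, $\nabla^2_{\mathcal{M}_h}\bar f(X,G)[\eta,\zeta]=(\bar KV^\top+H\bar V_p^\top,\ -\bar V_pV^\top-V\bar V_p^\top)$ with $\bar K\in\mathrm{T}_H\mathcal{H}^r$ and $V^\top\bar V_p=0$.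
   Context: Let $r\le\min\{m,n\}$ be a positive integer. The map $h:\mathbb{R}^{m\times n}\to\mathbb{R}^q$ is smooth and orthogonally invariant, i.e. $h(XQ)=h(X)$ for all $X$ and all $Q\in\mathcal{O}(n)=\{Q\in\mathbb{R}^{n\times n}:Q^\top Q=I_n\}$. Put $\mathcal{H}=\{X\in\mathbb{R}^{m\times n}:h(X)=0\}$; it is assumed that the differential $\mathrm{D}h_X$ has rank $q$ for all $X\in\mathcal{H}$ (so $\mathcal{H}$ is an embedded submanifold of $\mathbb{R}^{m\times n}$, with the metric inherited from the Frobenius inner product). Define $\mathcal{H}^r=\{H\in\mathbb{R}^{m\times r}:h([H\ \ 0^{m\times(n-r)}])=0\}$, an embedded submanifold of $\mathbb{R}^{m\times r}$ when nonempty, with tangent space $\mathrm{T}_H\mathcal{H}^r$ and normal space $\mathrm{N}_H\mathcal{H}^r$. $\mathrm{Sym}(n)$: symmetric $n\times n$ matrices; $\mathrm{Gr}(n,n-r)=\{G\in\mathrm{Sym}(n):G^2=G,\operatorname{rank}(G)=n-r\}$; $\mathrm{St}(n,r)=\{V\in\mathbb{R}^{n\times r}:V^\top V=I_r\}$. Define $\mathcal{M}_h=\{(X,G)\in\mathbb{R}^{m\times n}\times\mathrm{Gr}(n,n-r):XG=0,\ h(X)=0\}$, an embedded submanifold of $\mathcal{E}=\mathbb{R}^{m\times n}\times\mathrm{Sym}(n)$, and $\phi(X,G)=X$. A representation of $(X,G)\in\mathcal{M}_h$ is a pair $(H,V)\in\mathcal{H}^r\times\mathrm{St}(n,r)$ with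 $X=HV^\top$, $G=I-VV^\top$ (one always exists). The tangent space is $\mathrm{T}_{(X,G)}\mathcal{M}_h=\{(KV^\top+HV_p^\top,-V_pV^\top-VV_p^\top):K\in\mathrm{T}_H\mathcal{H}^r,\ V_p\in\mathbb{R}^{n\times r},\ V^\top V_p=0\}$, and $(K,V_p)$ is said to represent the tangent vector $(\eta,\zeta)=(KV^\top+HV_p^\top,-V_pV^\top-VV_p^\top)$; for such a vector $\eta\in\mathrm{T}_X\mathcal{H}$. For a fixed weight $\omega>0$, $\mathcal{M}_h$ carries the Riemannian metric inherited from the inner product $\langle(E_1,Z_1),(E_2,Z_2)\rangle_\omega=\langle E_1,E_2\rangle+\omega\langle Z_1,Z_2\rangle$ on $\mathcal{E}$, where $\langle A,B\rangle=\mathrm{tr}(A^\top B)$. $M_{H,\omega}=2\omega I+H^\top H$. $\mathcal{P}_{\mathcal{X}}$ denotes orthogonal projection onto $\mathcal{X}$ (Frobenius). $\nabla f,\nabla^2f$ are the Euclidean gradient and Hessian; $\nabla^2_{\mathcal{H}}f(X)$ is the Riemannian Hessian of $f|_{\mathcal{H}}$ at $X$ (a linear map on $\mathrm{T}_X\mathcal{H}$). *)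

theory Defs
  imports "HOL-Analysis.Analysis"
begin

section \<open>Differentiability and Euclidean derivatives\<close>

text \<open>
  The class C^k on the whole space. The recursion goes through the directional derivatives in
  each fixed direction, so that the type of the function does not change; for a
  finite-dimensional domain this is the usual notion.
\<close>

primrec Ck :: "nat \<Rightarrow> ('a::real_normed_vector \<Rightarrow> 'b::real_normed_vector) \<Rightarrow> bool" where
  "Ck 0 f \<longleftrightarrow> continuous_on UNIV f"
| "Ck (Suc k) f \<longleftrightarrow> (\<forall>x. f differentiable (at x)) \<and>
     (\<forall>v. Ck k (\<lambda>x. frechet_derivative f (at x) v))"

definition smooth :: "('a::real_normed_vector \<Rightarrow> 'b::real_normed_vector) \<Rightarrow> bool" where
  "smooth f \<longleftrightarrow> (\<forall>k. Ck k f)"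

text \<open>
  On \<open>real^'n^'m\<close> the library inner product is the Frobenius inner product, so these are the
  Frobenius gradient and Hessian of a function of a matrix.
\<close>

definition egrad :: "('a::real_inner \<Rightarrow> real) \<Rightarrow> 'a \<Rightarrow> 'a" where
  "egrad f x = (THE g. GDERIV f x :> g)"

definition ehess :: "('a::real_inner \<Rightarrow> real) \<Rightarrow> 'a \<Rightarrow> 'a \<Rightarrow> 'a" where
  "ehess f x u = frechet_derivative (egrad f) (at x) u"


section \<open>Riemannian geometry of submanifolds of a Euclidean space\<close>

text \<open>
  \<open>curve_through S x v c\<close>: \<open>c\<close> is a C^1 curve which near time 0 stays in \<open>S\<close>, with
  \<open>c(0) = x\<close> and \<open>c'(0) = v\<close>.
\<close>

definition curve_through ::
  "'a::real_normed_vector set \<Rightarrow> 'a \<Rightarrow> 'a \<Rightarrow> (real \<Rightarrow> 'a) \<Rightarrow> bool" where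
  "curve_through S x v c \<longleftrightarrow>
     (\<exists>e>0. c C1_differentiable_on {-e<..<e} \<and> (\<forall>t\<in>{-e<..<e}. c t \<in> S)) \<and>
     c 0 = x \<and> (c has_vector_derivative v) (at 0)"

definition tangent_space :: "'a::real_normed_vector set \<Rightarrow> 'a \<Rightarrow> 'a set" where
  "tangent_space S x = {v. \<exists>c. curve_through S x v c}"

definition normal_space_at :: "'a::euclidean_space set \<Rightarrow> 'a \<Rightarrow> 'a set" where
  "normal_space_at S x = orthogonal_comp (tangent_space S x)"

text \<open>
  The inner product \<open>ip\<close> on the ambient space is a parameter: it need not be the library
  inner product of the type, and it induces the Riemannian metric on the submanifold.
\<close>

definition orth_proj ::
  "('a::real_vector \<Rightarrow> 'a \<Rightarrow> real) \<Rightarrow> 'a set \<Rightarrow> 'a \<Rightarrow> 'a" where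
  "orth_proj ip T a = (THE p. p \<in> T \<and> (\<forall>s\<in>T. ip (a - p) s = 0))"

text \<open>
  The tangent vector at \<open>x\<close> which represents the differential of the restriction of \<open>f\<close> to
  \<open>M\<close>; only the values of \<open>f\<close> on \<open>M\<close> matter.
\<close>

definition riem_grad ::
  "('a::real_normed_vector \<Rightarrow> 'a \<Rightarrow> real) \<Rightarrow> 'a set \<Rightarrow> ('a \<Rightarrow> real) \<Rightarrow> 'a \<Rightarrow> 'a" where
  "riem_grad ip M f x =
     (THE g. g \<in> tangent_space M x \<and>
        (\<forall>v c. curve_through M x v c \<longrightarrow> ((\<lambda>t. f (c t)) has_real_derivative ip g v) (at 0)))"

text \<open>
  The covariant derivative of the gradient field in the direction \<open>u\<close>. The Levi-Civita
  connection of a submanifold with the metric inherited from a constant ambient inner product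
  is the tangential projection, orthogonal for that inner product, of the ambient derivative.
  The ambient derivative of the gradient, defined only on \<open>M\<close>, is taken along curves in \<open>M\<close>
  with velocity \<open>u\<close>; the result has to be the same for all of them.
\<close>

definition riem_hess ::
  "('a::real_normed_vector \<Rightarrow> 'a \<Rightarrow> real) \<Rightarrow> 'a set \<Rightarrow> ('a \<Rightarrow> real) \<Rightarrow> 'a \<Rightarrow> 'a \<Rightarrow> 'a" where
  "riem_hess ip M f x u =
     (THE w. \<forall>c. curve_through M x u c \<longrightarrow>
        (\<exists>D. ((\<lambda>t. riem_grad ip M f (c t)) has_vector_derivative D) (at 0) \<and>
             w = orth_proj ip (tangent_space M x) D))"


section \<open>Orthogonally invariant level sets and their space decoupling\<close>

definition orth_invariant :: "(real^'n^'m \<Rightarrow> 'b) \<Rightarrow> bool" where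
  "orth_invariant h \<longleftrightarrow> (\<forall>X Q. orthogonal_matrix Q \<longrightarrow> h (X ** Q) = h X)"

definition level_set :: "(real^'n^'m \<Rightarrow> real^'q) \<Rightarrow> (real^'n^'m) set" where
  "level_set h = {X. h X = 0}"

text \<open>
  The block matrix \<open>[H  0]\<close>. The columns of a matrix are indexed by an unordered finite type,
  so an injection \<open>\<iota>\<close> of the column indices of \<open>H\<close> singles out the ``first'' columns.
\<close>

definition pad :: "('r \<Rightarrow> 'n) \<Rightarrow> real^'r^'m \<Rightarrow> real^'n^'m" where
  "pad \<iota> H = (\<chi> i j. if j \<in> range \<iota> then H $ i $ inv \<iota> j else 0)"

definition level_set_r ::
  "('r \<Rightarrow> 'n) \<Rightarrow> (real^'n^'m \<Rightarrow> real^'q) \<Rightarrow> (real^'r^'m) set" where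
  "level_set_r \<iota> h = {H. h (pad \<iota> H) = 0}"

definition Gr :: "nat \<Rightarrow> (real^'n^'n) set" where
  "Gr k = {G. transpose G = G \<and> G ** G = G \<and> rank G = k}"

definition St :: "(real^'r^'n) set" where
  "St = {V. transpose V ** V = mat 1}"

text \<open>
  The type of the number \<open>r\<close> is passed explicitly. The set lies in the product of the matrix
  space with the symmetric matrices, a linear subspace of the ambient type that contains all
  curves in the set and all its tangent spaces; hence the larger ambient type changes neither
  tangent spaces, gradients nor Hessians.
\<close>

definition Mh :: "'r::finite itself \<Rightarrow> (real^'n^'m \<Rightarrow> real^'q) \<Rightarrow> ((real^'n^'m) \<times> (real^'n^'n)) set" where
  "Mh _ h = {(X, G). G \<in> Gr (CARD('n) - CARD('r)) \<and> X ** G = 0 \<and> h X = 0}"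

definition ip_omega ::
  "real \<Rightarrow> (real^'n^'m) \<times> (real^'n^'n) \<Rightarrow> (real^'n^'m) \<times> (real^'n^'n) \<Rightarrow> real" where
  "ip_omega \<omega> a b = fst a \<bullet> fst b + \<omega> * (snd a \<bullet> snd b)"

definition point_rep ::
  "('r \<Rightarrow> 'n) \<Rightarrow> (real^'n^'m \<Rightarrow> real^'q) \<Rightarrow> real^'r^'m \<Rightarrow> real^'r^'n \<Rightarrow>
     (real^'n^'m) \<times> (real^'n^'n) \<Rightarrow> bool" where
  "point_rep \<iota> h H V p \<longleftrightarrow>
     H \<in> level_set_r \<iota> h \<and> V \<in> St \<and>
     p = (H ** transpose V, mat 1 - V ** transpose V)"

definition tangent_rep ::
  "('r \<Rightarrow> 'n) \<Rightarrow> (real^'n^'m \<Rightarrow> real^'q) \<Rightarrow> real^'r^'m \<Rightarrow> real^'r^'n \<Rightarrow>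
     real^'r^'m \<Rightarrow> real^'r^'n \<Rightarrow> (real^'n^'m) \<times> (real^'n^'n) \<Rightarrow> bool" where
  "tangent_rep \<iota> h H V K Vp w \<longleftrightarrow>
     K \<in> tangent_space (level_set_r \<iota> h) H \<and> transpose V ** Vp = 0 \<and>
     w = (K ** transpose V + H ** transpose Vp,
          - (Vp ** transpose V) - V ** transpose Vp)"

definition M_mat :: "real \<Rightarrow> real^'r^'m \<Rightarrow> real^'r^'r" where
  "M_mat \<omega> H = mat (2 * \<omega>) + transpose H ** H"

definition W_mat :: "real \<Rightarrow> real^'r^'m \<Rightarrow> real^'m^'m" where
  "W_mat \<omega> H = mat 1 - H ** matrix_inv (M_mat \<omega> H) ** transpose H"

end

theory Submission
  imports Defs
begin

text \<open>
  Write \<open>\<Pi> = I - G\<close>, \<open>J\<close> for the differential of \<open>h\<close> at \<open>X\<close>, \<open>M = 2\<omega>I + X\<^sup>TX\<close>, and \<open>\<gamma>\<close> for the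
  Riemannian gradient of \<open>f\<close> on the level set \<open>h = 0\<close>. As all metrics are inherited from a constant
  inner product, gradients are orthogonal projections of Euclidean gradients, and Hessians are
  orthogonal projections of the derivatives of gradient fields along curves.

  If \<open>XG = 0\<close>, the reflection \<open>I - 2G\<close> fixes \<open>X\<close> and changes the sign of \<open>LG\<close>, so invariance gives
  \<open>J(LG) = 0\<close> for every \<open>L\<close> (\<open>J_kernel\<close>). Hence only \<open>L\<Pi>\<close> matters for \<open>J\<close>, and the normal vectors \<open>\<nu>\<close> of
  the level set at \<open>X\<close> satisfy \<open>\<nu>G = 0\<close>. The tangent space at \<open>(X, G)\<close> then is the set of the pairs
  \<open>(Y + XA\<^sup>T, -(A + A\<^sup>T))\<close> with \<open>JY = 0\<close>, \<open>YG = 0\<close>, \<open>A = GA\<Pi>\<close> (\<open>tangent_space_Mh\<close>). Necessity is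
  differentiation of the defining equations; for sufficiency, a curve through \<open>X\<close> in the level set
  that keeps the kernel relation \<open>XG = 0\<close>, given by the inverse function theorem, is rotated by the
  Cayley transform of \<open>t(A - A\<^sup>T)\<close>.

  The \<open>Y\<close> and the \<open>A\<close> directions are orthogonal, and the \<open>\<omega>\<close>-metric on the latter is multiplication
  by \<open>M\<close>. Projecting \<open>(\<nabla>f, 0)\<close> therefore gives the gradient
  \<open>(\<gamma>\<Pi> + XB\<^sup>T, -(B + B\<^sup>T))\<close> with \<open>BM = G\<gamma>\<^sup>TX\<close> (\<open>riem_grad_Mh\<close>). This expression involves \<open>f\<close> only
  through \<open>\<gamma>\<close>, so its derivative along a curve involves \<open>f\<close> only through \<open>\<gamma>\<close> and \<open>\<gamma>'\<close>, and the
  tangential part of \<open>\<gamma>'\<close> is the Hessian on the level set. In the projection of that derivative the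
  off-diagonal part \<open>C\<close> satisfies, by the product rule applied to \<open>BM = G\<gamma>\<^sup>TX\<close>,
  \<open>CM = G\<gamma>'\<^sup>TX + (G\<gamma>\<^sup>T - BX\<^sup>T)\<eta>\<Pi>\<close>: differentiating this equation, and not \<open>B\<close>, avoids the derivative of
  \<open>M\<^sup>-\<^sup>1\<close>, and the terms with the derivatives of \<open>G\<close> and of \<open>\<Pi>\<close> cancel (\<open>riem_hess_Mh\<close>).

  Finally \<open>X = HV\<^sup>T\<close> and \<open>M\<^sup>-\<^sup>1V = VM\<^sub>H\<^sup>-\<^sup>1\<close>, where \<open>M\<^sub>H = 2\<omega>I + H\<^sup>TH\<close>, turn this into the stated formulas.
  The normal projection enters there because \<open>\<nu>G = 0\<close> holds along curves in the manifold for
  \<open>\<nu> = \<nabla>f - \<gamma>\<close>, so that \<open>\<gamma>'G = \<nabla>\<^sup>2f[\<eta>]G + \<nu>\<zeta>\<close>.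
\<close>

section \<open>Matrix calculus\<close>

lemma bounded_bilinear_matrix_mult:
  "bounded_bilinear ((**) :: real^'b^'a \<Rightarrow> real^'c^'b \<Rightarrow> real^'c^'a)"
  unfolding bilinear_conv_bounded_bilinear[symmetric]
  by (auto simp: bilinear_def matrix_matrix_mult_def vec_eq_iff algebra_simps sum.distrib
      sum_distrib_left intro!: linearI)

interpretation matmul: bounded_bilinear "(**) :: real^'b^'a \<Rightarrow> real^'c^'b \<Rightarrow> real^'c^'a"
  by (rule bounded_bilinear_matrix_mult)

lemma bounded_linear_transpose: "bounded_linear (transpose :: real^'b^'a \<Rightarrow> real^'a^'b)"
  unfolding linear_conv_bounded_linear[symmetric]
  by (auto simp: transpose_def vec_eq_iff intro!: linearI)

lemmas transpose_linear =
  linear_add[OF bounded_linear.linear[OF bounded_linear_transpose]]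
  linear_diff[OF bounded_linear.linear[OF bounded_linear_transpose]]
  linear_neg[OF bounded_linear.linear[OF bounded_linear_transpose]]
  linear_0[OF bounded_linear.linear[OF bounded_linear_transpose]]
  linear_scale[OF bounded_linear.linear[OF bounded_linear_transpose]]

lemma inner_transpose: "transpose A \<bullet> transpose B = (A :: real^'b^'a) \<bullet> B"
  unfolding inner_vec_def transpose_def by (simp, rule sum.swap)

lemma inner_mult_right: "(A ** B) \<bullet> C = A \<bullet> (C ** transpose B)"
  for A :: "real^'b^'a" and B :: "real^'c^'b"
proof -
  have "(A ** B) \<bullet> C = (\<Sum>i\<in>UNIV. \<Sum>j\<in>UNIV. \<Sum>k\<in>UNIV. A$i$k * B$k$j * C$i$j)"
    unfolding inner_vec_def matrix_matrix_mult_def by (simp add: sum_distrib_right)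
  also have "\<dots> = (\<Sum>i\<in>UNIV. \<Sum>k\<in>UNIV. \<Sum>j\<in>UNIV. A$i$k * B$k$j * C$i$j)"
    by (intro sum.cong refl sum.swap)
  also have "\<dots> = A \<bullet> (C ** transpose B)"
    unfolding inner_vec_def matrix_matrix_mult_def transpose_def
    by (simp add: sum_distrib_left mult_ac)
  finally show ?thesis .
qed

lemma inner_mult_left: "(A ** B) \<bullet> C = B \<bullet> (transpose A ** C)"
  for A :: "real^'b^'a" and B :: "real^'c^'b"
proof -
  have "(A ** B) \<bullet> C = (transpose B ** transpose A) \<bullet> transpose C"
    by (metis inner_transpose matrix_transpose_mul)
  also have "\<dots> = transpose B \<bullet> transpose (transpose A ** C)"
    by (simp add: inner_mult_right matrix_transpose_mul)
  finally show ?thesis by (simp only: inner_transpose)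
qed

lemma matrix_inv_mult:
  fixes A :: "real^'a^'a"
  assumes "invertible A"
  shows "A ** matrix_inv A = mat 1" "matrix_inv A ** A = mat 1"
proof -
  have "A ** matrix_inv A = mat 1 \<and> matrix_inv A ** A = mat 1"
    unfolding matrix_inv_def by (rule someI_ex) (use assms in \<open>simp add: invertible_def\<close>)
  then show "A ** matrix_inv A = mat 1" "matrix_inv A ** A = mat 1" by auto
qed

lemma invertible_if_ker:
  fixes A :: "real^'a^'a"
  assumes "\<And>v. A *v v = 0 \<Longrightarrow> v = 0"
  shows "invertible A"
  using assms by (simp add: invertible_left_inverse matrix_left_invertible_ker)

lemma differentiable_det:
  fixes A :: "'x::real_normed_vector \<Rightarrow> real^'a^'a"
  assumes "\<And>i j. (\<lambda>y. A y $ i $ j) differentiable at x"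
  shows "(\<lambda>y. det (A y)) differentiable at x"
proof -
  have *: "(\<lambda>y. \<Prod>i\<in>UNIV. A y $ i $ p i) differentiable at x" for p
  proof -
    have "\<forall>i. \<exists>d. ((\<lambda>y. A y $ i $ p i) has_derivative d) (at x)"
      using assms by (auto simp: differentiable_def)
    then obtain d where "\<And>i. ((\<lambda>y. A y $ i $ p i) has_derivative d i) (at x)" by metis
    then show ?thesis
      unfolding differentiable_def by (intro exI) (rule has_derivative_prod, auto)
  qed
  show ?thesis unfolding det_def
    by (intro differentiable_sum differentiable_mult differentiable_const ballI *) (auto simp: finite_permutations)
qed

lemma differentiable_matrix_iff:
  fixes A :: "'x::real_normed_vector \<Rightarrow> real^'a^'b"
  shows "A differentiable at x \<longleftrightarrow> (\<forall>i j. (\<lambda>y. A y $ i $ j) differentiable at x)"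
proof
  assume "A differentiable at x"
  then obtain D where "(A has_derivative D) (at x)" by (auto simp: differentiable_def)
  then have "((\<lambda>y. A y $ i $ j) has_derivative (\<lambda>u. D u $ i $ j)) (at x)" for i j
    by (intro bounded_linear.has_derivative[OF bounded_linear_vec_nth])
  then show "\<forall>i j. (\<lambda>y. A y $ i $ j) differentiable at x"
    by (blast intro: differentiableI)
next
  assume "\<forall>i j. (\<lambda>y. A y $ i $ j) differentiable at x"
  then show "A differentiable at x"
    unfolding differentiable_componentwise_within[where f=A]
    by (auto simp: Basis_vec_def inner_axis)
qed

lemma matrix_inv_entry:
  fixes A :: "real^'a^'a"
  assumes "det A \<noteq> 0"
  shows "matrix_inv A $ i $ j = det (\<chi> r c. if c = i then axis j 1 $ r else A $ r $ c) / det A"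
proof -
  have inv: "invertible A" using assms by (simp add: invertible_det_nz)
  have "A *v (matrix_inv A *v axis j 1) = axis j 1"
    using matrix_inv_mult[OF inv] by (simp add: matrix_vector_mul_assoc)
  then have "matrix_inv A *v axis j 1 = (\<chi> k. det (\<chi> r c. if c = k then axis j 1 $ r else A $ r $ c) / det A)"
    using cramer[OF assms, of _ "axis j 1"] by simp
  moreover have "matrix_inv A $ i $ j = (matrix_inv A *v axis j 1) $ i"
    by (simp add: matrix_vector_mult_basis column_def)
  ultimately show ?thesis by simp
qed

text \<open>
  Cramer's rule makes every entry of the inverse a quotient of determinants, and these are
  polynomials in the entries of the matrix.
\<close>

lemma differentiable_matrix_inv:
  fixes A :: "'x::real_normed_vector \<Rightarrow> real^'a^'a"
  assumes A: "A differentiable at x" and inv: "invertible (A x)"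
  shows "(\<lambda>y. matrix_inv (A y)) differentiable at x"
proof -
  have ent: "(\<lambda>y. A y $ i $ j) differentiable at x" for i j
    using A differentiable_matrix_iff by blast
  have dt: "(\<lambda>y. det (A y)) differentiable at x"
    by (rule differentiable_det) (rule ent)
  have nz: "det (A x) \<noteq> 0" using inv by (simp add: invertible_det_nz)
  have "isCont (\<lambda>y. det (A y)) x" using dt by (rule differentiable_imp_continuous_within)
  then obtain e where e: "e > 0" "\<And>y. dist y x < e \<Longrightarrow> det (A y) \<noteq> 0"
    using continuous_at_avoid[of x "\<lambda>y. det (A y)" 0] nz by (metis dist_commute)
  have "(\<lambda>y. matrix_inv (A y) $ i $ j) differentiable at x" for i j
  proof -
    have "(\<lambda>y. det (\<chi> r c. if c = i then axis j 1 $ r else A y $ r $ c) / det (A y)) differentiable at x"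
    proof (intro differentiable_divide dt nz differentiable_det)
      fix r c show "(\<lambda>y. (\<chi> r c. if c = i then axis j 1 $ r else A y $ r $ c) $ r $ c) differentiable at x"
        by (cases "c = i") (auto simp: ent)
    qed
    then show ?thesis
      by (rule differentiable_transform_within[OF _ e(1)]) (auto simp: matrix_inv_entry e(2))
  qed
  then show ?thesis by (simp add: differentiable_matrix_iff)
qed

text \<open>
  Rewriting right-nested matrix products with \<open>A ** B = C\<close> also has to reach occurrences of
  \<open>A ** B\<close> that are followed by further factors. Since the conclusion is polymorphic in the width of
  the last factor, \<open>mult_chain[OF eq]\<close> serves all products in a calculation.
\<close>

lemma mult_chain: "A ** B = C \<Longrightarrow> A ** (B ** Z) = C ** (Z :: real^'d^'c)"
  for A :: "real^'b^'a" and B :: "real^'c^'b"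
  by (simp add: matrix_mul_assoc)

lemmas mult_distrib = matmul.add_left matmul.add_right matmul.diff_left matmul.diff_right
  matmul.minus_left matmul.minus_right matmul.zero_left matmul.zero_right
  matmul.scaleR_left matmul.scaleR_right

lemma inner_matrix_vector: "(A *v x) \<bullet> y = x \<bullet> (transpose A *v y)" for A :: "real^'b^'a"
  by (metis dot_lmul_matrix inner_commute transpose_matrix_vector)

lemmas mat_simps = mult_distrib transpose_linear matrix_transpose_mul matrix_mul_assoc[symmetric]

lemma C1_differentiable_on_matrix_mult:
  fixes A :: "real \<Rightarrow> real^'b^'a" and B :: "real \<Rightarrow> real^'c^'b"
  assumes "A C1_differentiable_on S" "B C1_differentiable_on S"
  shows "(\<lambda>t. A t ** B t) C1_differentiable_on S"
proof -
  obtain A' B' where A: "\<And>t. t \<in> S \<Longrightarrow> (A has_vector_derivative A' t) (at t)" "continuous_on S A'"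
    and B: "\<And>t. t \<in> S \<Longrightarrow> (B has_vector_derivative B' t) (at t)" "continuous_on S B'"
    using assms unfolding C1_differentiable_on_def by blast
  have "continuous_on S A" "continuous_on S B"
    using A(1) B(1) by (auto intro!: continuous_at_imp_continuous_on has_vector_derivative_continuous)
  then have "continuous_on S (\<lambda>t. A t ** B' t + A' t ** B t)"
    by (intro continuous_on_add matmul.continuous_on A(2) B(2))
  moreover have "((\<lambda>t. A t ** B t) has_vector_derivative (A t ** B' t + A' t ** B t)) (at t)" if "t \<in> S" for t
    by (rule matmul.has_vector_derivative[OF A(1)[OF that] B(1)[OF that]])
  ultimately show ?thesis
    unfolding C1_differentiable_on_def
    by (intro exI[of _ "\<lambda>t. A t ** B' t + A' t ** B t"] conjI ballI)
qed

lemma C1_differentiable_on_bounded_linear: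
  assumes "bounded_linear F" "A C1_differentiable_on S"
  shows "(\<lambda>t. F (A t)) C1_differentiable_on S"
proof -
  obtain A' where A: "\<And>t. t \<in> S \<Longrightarrow> (A has_vector_derivative A' t) (at t)" "continuous_on S A'"
    using assms(2) unfolding C1_differentiable_on_def by blast
  show ?thesis
    unfolding C1_differentiable_on_def
    by (intro exI[of _ "\<lambda>t. F (A' t)"] conjI ballI bounded_linear.has_vector_derivative[OF assms(1)]
        bounded_linear.continuous_on[OF assms(1)] A)
qed

text \<open>
  The Cayley transform \<open>(I - t\<Omega>/2)\<^sup>-\<^sup>1(I + t\<Omega>/2)\<close>, written as \<open>2R - I\<close> with
  \<open>R = (I - t\<Omega>/2)\<^sup>-\<^sup>1\<close>, gives a curve of orthogonal matrices with initial velocity \<open>\<Omega>\<close>: with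
  \<open>N = I - t\<Omega>/2\<close> one has \<open>N + N\<^sup>T = 2I\<close>, whence \<open>2RR\<^sup>T = R + R\<^sup>T\<close>. The inverse exists since \<open>v \<bullet> \<Omega>v = 0\<close> for skew \<open>\<Omega>\<close>.
\<close>

lemma cayley_curve:
  fixes \<Omega> :: "real^'n^'n"
  assumes skew: "transpose \<Omega> = - \<Omega>"
  obtains Q :: "real \<Rightarrow> real^'n^'n" where "\<And>t. orthogonal_matrix (Q t)" "Q 0 = mat 1"
    "(Q has_vector_derivative \<Omega>) (at 0)" "\<And>S. Q C1_differentiable_on S"
proof -
  define N where "N t = mat 1 - (t/2) *\<^sub>R \<Omega>" for t :: real
  define R where "R t = matrix_inv (N t)" for t
  have dN: "(N has_vector_derivative - ((1/2) *\<^sub>R \<Omega>)) (at t)" for t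
    unfolding N_def by (auto intro!: derivative_eq_intros simp: algebra_simps)
  have inv: "invertible (N t)" for t
  proof (rule invertible_if_ker)
    fix v assume "N t *v v = 0"
    then have v: "v = (t/2) *\<^sub>R (\<Omega> *v v)"
      by (simp add: N_def matrix_vector_mult_diff_rdistrib scaleR_matrix_vector_assoc)
    have "(\<Omega> *v v) \<bullet> v = - (v \<bullet> (\<Omega> *v v))"
      using matrix_vector_mult_diff_rdistrib[of 0 \<Omega> v]
      by (simp add: inner_matrix_vector skew del: transpose_matrix_vector)
    then have "v \<bullet> (\<Omega> *v v) = 0" by (simp add: inner_commute)
    then have "v \<bullet> v = 0" using v by (metis inner_scaleR_right mult_zero_right)
    then show "v = 0" by simp
  qed
  have NR: "N t ** R t = mat 1" and RN: "R t ** N t = mat 1" for t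
    unfolding R_def using matrix_inv_mult[OF inv] by auto
  have dR: "(R has_vector_derivative (R t ** ((1/2) *\<^sub>R \<Omega>) ** R t)) (at t)" for t
  proof -
    have "N differentiable at t" using dN differentiableI_vector by blast
    then have "R differentiable at t" unfolding R_def[abs_def] using inv by (rule differentiable_matrix_inv)
    then obtain D where D: "(R has_vector_derivative D) (at t)"
      using vector_derivative_works by blast
    have "((\<lambda>t. N t ** R t) has_vector_derivative (N t ** D + (- ((1/2) *\<^sub>R \<Omega>)) ** R t)) (at t)"
      by (rule matmul.has_vector_derivative[OF dN D])
    then have "N t ** D + (- ((1/2) *\<^sub>R \<Omega>)) ** R t = 0"
      unfolding NR by (rule vector_derivative_unique_at) (rule has_vector_derivative_const)
    then have "N t ** D = (1/2) *\<^sub>R \<Omega> ** R t" by (simp add: mult_distrib)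
    then have "R t ** (N t ** D) = R t ** ((1/2) *\<^sub>R \<Omega> ** R t)" by simp
    then have "D = R t ** ((1/2) *\<^sub>R \<Omega>) ** R t" by (simp add: matrix_mul_assoc RN)
    then show ?thesis using D by simp
  qed
  define Q where "Q t = 2 *\<^sub>R R t - mat 1" for t
  have dQ: "(Q has_vector_derivative 2 *\<^sub>R (R t ** ((1/2) *\<^sub>R \<Omega>) ** R t)) (at t)" for t
    unfolding Q_def by (auto intro!: derivative_eq_intros dR)
  have Rcont: "continuous_on S R" for S
    using dR by (auto intro!: continuous_at_imp_continuous_on has_vector_derivative_continuous)
  have R0: "R 0 = mat 1" using NR[of 0] by (simp add: N_def)
  show thesis
  proof
    fix t
    have N: "N t + transpose (N t) = 2 *\<^sub>R mat 1"
      by (simp add: N_def transpose_linear skew scaleR_2)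
    have NRT: "transpose (N t) ** transpose (R t) = mat 1"
      using RN[of t] matrix_transpose_mul[of "R t" "N t"] by simp
    have "R t ** (N t + transpose (N t)) ** transpose (R t) = transpose (R t) + R t"
      by (simp add: mult_distrib RN matrix_mul_assoc[symmetric] NRT mult_chain[OF RN])
    then have RR: "2 *\<^sub>R (R t ** transpose (R t)) = transpose (R t) + R t"
      by (simp add: N mult_distrib)
    have "Q t ** transpose (Q t) = 2 *\<^sub>R (2 *\<^sub>R (R t ** transpose (R t))) - 2 *\<^sub>R R t - 2 *\<^sub>R transpose (R t) + mat 1"
      by (simp add: Q_def transpose_linear mult_distrib algebra_simps)
    also have "\<dots> = mat 1" unfolding RR by (simp add: algebra_simps)
    finally show "orthogonal_matrix (Q t)"
      by (metis orthogonal_matrix_transpose orthogonal_matrix transpose_transpose)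
  next
    show "Q 0 = mat 1" by (simp add: Q_def R0 scaleR_2)
    show "(Q has_vector_derivative \<Omega>) (at 0)"
      using dQ[of 0] by (simp add: R0)
    show "Q C1_differentiable_on S" for S
      unfolding C1_differentiable_on_def
      by (intro exI[of _ "\<lambda>t. 2 *\<^sub>R (R t ** ((1/2) *\<^sub>R \<Omega>) ** R t)"] conjI ballI dQ
          continuous_on_scaleR matmul.continuous_on continuous_on_const Rcont)
  qed
qed

lemma rank_orthogonal_conjugate:
  fixes G Q :: "real^'k^'k"
  assumes "orthogonal_matrix Q"
  shows "rank (Q ** G ** transpose Q) = rank G"
proof (rule antisym)
  show "rank (Q ** G ** transpose Q) \<le> rank G"
    using rank_mul_le_left[of "Q ** G" "transpose Q"] rank_mul_le_right[of Q G] by linarith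
  have QQ: "transpose Q ** Q = mat 1" using assms by (simp add: orthogonal_matrix)
  have "G = transpose Q ** (Q ** G ** transpose Q) ** Q"
    by (simp add: mat_simps QQ mult_chain[OF QQ])
  then show "rank G \<le> rank (Q ** G ** transpose Q)"
    by (metis order_trans rank_mul_le_left rank_mul_le_right)
qed

section \<open>Orthonormal frames\<close>

lemma dim_ker_orthonormal_frame:
  fixes V :: "real^'r^'n"
  assumes V: "transpose V ** V = mat 1"
  shows "dim {x. transpose V *v x = 0} + CARD('r) = CARD('n)"
proof -
  have inj: "inj ((*v) V)"
    by (rule inj_on_inverseI[of _ "(*v) (transpose V)"])
      (simp add: matrix_vector_mul_assoc V del: transpose_matrix_vector)
  have "{x. transpose V *v x = 0} = {y \<in> UNIV. \<forall>x \<in> range ((*v) V). orthogonal x y}"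
    by (auto simp: orthogonal_def inner_matrix_vector simp del: transpose_matrix_vector)
      (metis inner_eq_zero_iff)
  moreover have "dim (range ((*v) V)) = CARD('r)"
    using dim_image_eq[of "(*v) V" UNIV] inj by simp
  moreover have "dim {y \<in> UNIV. \<forall>x \<in> range ((*v) V). orthogonal x y} + dim (range ((*v) V)) = dim (UNIV :: (real^'n) set)"
    by (rule dim_subspace_orthogonal_to_vectors)
      (auto intro: linear_subspace_image[OF matrix_vector_mul_linear subspace_UNIV])
  ultimately show ?thesis by simp
qed

text \<open>
  The orthogonal complements of the two column spaces have equal dimension; an isometry between
  them completes \<open>P y \<mapsto> V y\<close> to an isometry of the whole space.
\<close>

lemma orthogonal_matrix_between_frames:
  fixes P V :: "real^'r^'n"
  assumes P: "transpose P ** P = mat 1" and V: "transpose V ** V = mat 1"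
  obtains Q where "orthogonal_matrix Q" "Q ** P = V"
proof -
  let ?S = "{x. transpose P *v x = 0}" and ?T = "{x. transpose V *v x = 0}"
  have sub: "subspace {x. transpose A *v x = 0}" for A :: "real^'r^'n"
    by (rule linear_subspace_kernel) (rule matrix_vector_mul_linear)
  have "dim ?S = dim ?T"
    using dim_ker_orthonormal_frame[OF P] dim_ker_orthonormal_frame[OF V] by linarith
  then obtain f where f: "linear f" "f ` ?S = ?T" "\<And>x. x \<in> ?S \<Longrightarrow> norm (f x) = norm x"
    using isometry_subspaces[OF sub sub] by metis
  define q where "q x = V *v (transpose P *v x) + f (x - P *v (transpose P *v x))" for x
  have qlin: "linear q"
    unfolding q_def
    by (intro linear_compose_add linear_compose[OF _ matrix_vector_mul_linear, unfolded o_def]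
        linear_compose[OF _ f(1), unfolded o_def] linear_compose_sub matrix_vector_mul_linear linear_ident)
  have qnorm: "norm (q x) = norm x" for x
  proof -
    define a where "a = transpose P *v x"
    define z where "z = x - P *v a"
    have z: "transpose P *v z = 0"
      unfolding z_def a_def
      by (simp add: matrix_vector_mult_diff_distrib matrix_vector_mul_assoc matrix_mul_assoc P
          del: transpose_matrix_vector)
    have fz: "transpose V *v f z = 0" using f(2) z by blast
    have "q x \<bullet> q x = (V *v a) \<bullet> (V *v a) + f z \<bullet> f z"
      unfolding q_def a_def[symmetric] z_def[symmetric]
      using inner_matrix_vector[of V a "f z"] fz
      by (simp add: inner_add_left inner_add_right inner_commute del: transpose_matrix_vector)
    also have "(V *v a) \<bullet> (V *v a) = a \<bullet> a"
      by (simp add: inner_matrix_vector matrix_vector_mul_assoc V del: transpose_matrix_vector)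
    also have "f z \<bullet> f z = z \<bullet> z" using f(3)[of z] z by (simp add: norm_eq)
    also have "a \<bullet> a = (P *v a) \<bullet> (P *v a)"
      by (simp add: inner_matrix_vector matrix_vector_mul_assoc P del: transpose_matrix_vector)
    also have "(P *v a) \<bullet> (P *v a) + z \<bullet> z = (P *v a + z) \<bullet> (P *v a + z)"
      using inner_matrix_vector[of P a z] z
      by (simp add: inner_add_left inner_add_right inner_commute del: transpose_matrix_vector)
    also have "P *v a + z = x" by (simp add: z_def)
    finally show ?thesis by (simp add: norm_eq)
  qed
  have "orthogonal_transformation q"
    using qlin qnorm by (simp add: orthogonal_transformation)
  then have "orthogonal_matrix (matrix q)" by (simp add: orthogonal_transformation_matrix)
  moreover have "matrix q ** P = V"
    unfolding matrix_eq
  proof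
    fix y
    have "(matrix q ** P) *v y = q (P *v y)"
      using matrix_works[of q] qlin by (simp add: matrix_vector_mul_assoc[symmetric] linear_matrix_vector_mul_eq)
    also have "\<dots> = V *v y"
      unfolding q_def
      by (simp add: matrix_vector_mul_assoc P linear_0[OF f(1)] del: transpose_matrix_vector)
    finally show "(matrix q ** P) *v y = V *v y" .
  qed
  ultimately show thesis by (rule that)
qed

section \<open>Curves in level sets\<close>

lemma Ck_Suc_D:
  assumes "Ck (Suc k) h"
  shows "(h has_derivative frechet_derivative h (at x)) (at x)"
    and "Ck k (\<lambda>x. frechet_derivative h (at x) v)"
  using assms by (auto simp: frechet_derivative_works)

text \<open>
  This is the implicit function theorem in the form needed here. The derivative at \<open>x\<close> of
  \<open>\<Phi>(y) = y - x + B(h y - J(y - x))\<close> is the identity, so \<open>\<Phi>\<close> has a local inverse \<open>g\<close>, and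
  \<open>c(t) = g(tv)\<close> is the curve: applying \<open>J\<close> to \<open>\<Phi>(c(t)) = tv\<close> gives \<open>h(c(t)) = 0\<close>. The freedom to
  choose the right inverse \<open>B\<close> of \<open>J\<close> lets the curve stay in an affine subspace, by the last
  conclusion.
\<close>

lemma level_set_curve:
  fixes h :: "'a::euclidean_space \<Rightarrow> 'b::euclidean_space"
  defines "J \<equiv> \<lambda>x. frechet_derivative h (at x)"
  assumes C1: "Ck 1 h" and x: "h x = 0"
    and B: "linear B" and JB: "\<And>w. J x (B w) = w" and v: "J x v = 0"
  obtains c e where "e > 0" "c C1_differentiable_on {-e<..<e}" "c 0 = x"
    "(c has_vector_derivative v) (at 0)"
    "\<And>t. \<bar>t\<bar> < e \<Longrightarrow> h (c t) = 0"
    "\<And>t. \<bar>t\<bar> < e \<Longrightarrow> \<exists>w. c t = x + t *\<^sub>R v + B w"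
proof -
  have J: "(h has_derivative J y) (at y)" for y
    unfolding J_def by (rule Ck_Suc_D(1)[of 0]) (use C1 in simp)
  have Jcont: "continuous_on UNIV (\<lambda>y. J y u)" for u
    unfolding J_def using C1 by simp
  have Jlin: "bounded_linear (J y)" for y using J has_derivative_bounded_linear by blast
  interpret J: bounded_linear "J x" by (rule Jlin)
  have Bbl: "bounded_linear B" using B by (simp add: linear_conv_bounded_linear)
  interpret B: bounded_linear B by (rule Bbl)
  define \<Phi> where "\<Phi> y = y - x + B (h y - J x (y - x))" for y
  define F where "F y = Blinfun (\<lambda>u. u + B (J y u - J x u))" for y
  have Fbl: "bounded_linear (\<lambda>u. u + B (J y u - J x u))" for y
    by (intro bounded_linear_add bounded_linear_ident bounded_linear_compose[OF Bbl]
        bounded_linear_sub Jlin)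
  have F: "blinfun_apply (F y) u = u + B (J y u - J x u)" for y u
    unfolding F_def by (simp add: bounded_linear_Blinfun_apply[OF Fbl])
  have Fx: "F x = id_blinfun"
    by (rule blinfun_eqI) (simp add: F B.zero)
  have d\<Phi>: "(\<Phi> has_derivative blinfun_apply (F y)) (at y)" for y
    unfolding \<Phi>_def F
    by (auto intro!: derivative_eq_intros J bounded_linear.has_derivative[OF Bbl]
        bounded_linear.has_derivative[OF Jlin[of x]])
  have Fcont: "continuous_on UNIV F"
    by (rule continuous_on_blinfun_componentwise)
      (auto simp: F intro!: continuous_intros bounded_linear.continuous_on[OF Bbl] Jcont)
  have inv: "id_blinfun o\<^sub>L F x = id_blinfun"
    by (rule blinfun_eqI) (simp add: Fx)
  obtain U' V g g' where V: "open V" "\<Phi> x \<in> V" and hom: "homeomorphism U' V \<Phi> g"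
    and xU: "x \<in> U'"
    and g: "\<And>y. y \<in> V \<Longrightarrow> (g has_derivative (g' y)) (at y)"
    and g': "\<And>y. y \<in> V \<Longrightarrow> g' y = inv (blinfun_apply (F (g y)))"
    and bij: "\<And>y. y \<in> V \<Longrightarrow> bij (blinfun_apply (F (g y)))"
    using inverse_function_theorem[OF open_UNIV d\<Phi> Fcont UNIV_I inv] by metis
  have \<Phi>x: "\<Phi> x = 0" by (simp add: \<Phi>_def x B.zero J.zero)
  have V0: "0 \<in> V" using V \<Phi>x by simp
  have g0: "g 0 = x" using hom xU \<Phi>x by (metis homeomorphism_apply1)
  have \<Phi>g: "\<Phi> (g z) = z" if "z \<in> V" for z using hom that by (metis homeomorphism_apply2)
  have gcont: "continuous_on V g" using hom by (simp add: homeomorphism_def)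
  have Fg: "continuous_on V (\<lambda>z. F (g z))"
    by (rule continuous_on_compose2[OF Fcont gcont]) simp
  have "open (V \<inter> (\<lambda>z. F (g z)) -` ball id_blinfun (1/2))"
    by (rule continuous_open_preimage[OF Fg V(1) open_ball])
  also have "V \<inter> (\<lambda>z. F (g z)) -` ball id_blinfun (1/2) = {z\<in>V. dist (F (g z)) id_blinfun < 1/2}"
    by (auto simp: dist_commute)
  finally have "open {z\<in>V. dist (F (g z)) id_blinfun < 1/2}" .
  moreover have "0 \<in> {z\<in>V. dist (F (g z)) id_blinfun < 1/2}"
    using V0 by (simp add: g0 Fx)
  ultimately obtain d where d: "d > 0" "ball 0 d \<subseteq> {z\<in>V. dist (F (g z)) id_blinfun < 1/2}"
    by (meson openE)
  define e where "e = d / (norm v + 1)"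
  have e0: "e > 0" using d(1) by (simp add: e_def add_nonneg_pos)
  have small: "t *\<^sub>R v \<in> V \<and> dist (F (g (t *\<^sub>R v))) id_blinfun < 1/2" if "\<bar>t\<bar> < e" for t
  proof -
    have "\<bar>t\<bar> * norm v \<le> \<bar>t\<bar> * (norm v + 1)" by (simp add: mult_left_mono)
    also have "\<dots> < d" using that by (simp add: e_def pos_less_divide_eq add_nonneg_pos)
    finally show ?thesis using d(2) by (auto simp: subset_eq)
  qed
  define c where "c t = g (t *\<^sub>R v)" for t
  define D where "D t = g' (t *\<^sub>R v) v" for t
  have cD: "(c has_vector_derivative D t) (at t)" if "\<bar>t\<bar> < e" for t
  proof -
    have gd: "(g has_derivative g' (t *\<^sub>R v)) (at (t *\<^sub>R v))" using small[OF that] g by blast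
    have "((\<lambda>t. t *\<^sub>R v) has_vector_derivative v) (at t)"
      by (auto intro!: derivative_eq_intros)
    then have "((\<lambda>t. t *\<^sub>R v) has_derivative (\<lambda>s. s *\<^sub>R v)) (at t)"
      by (simp add: has_vector_derivative_def)
    from diff_chain_at[OF this gd] show ?thesis
      using linear_scale[OF has_derivative_linear[OF gd]]
      by (simp add: has_vector_derivative_def c_def[abs_def] o_def D_def)
  qed
  have FD: "blinfun_apply (F (c t)) (D t) = v" if "\<bar>t\<bar> < e" for t
    using small[OF that] bij[of "t *\<^sub>R v"] g'[of "t *\<^sub>R v"]
    by (simp add: c_def D_def bij_is_surj surj_f_inv_f)
  \<comment> \<open>Closeness of \<open>F (c t)\<close> to the identity bounds its inverse uniformly, which gives
    continuity of the velocity \<open>D\<close> of the curve.\<close>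
  have low: "norm u \<le> 2 * norm (blinfun_apply (F (c t)) u)" if "\<bar>t\<bar> < e" for t u
  proof -
    have "norm (blinfun_apply (F (c t) - id_blinfun) u) \<le> norm (F (c t) - id_blinfun) * norm u"
      by (rule norm_blinfun)
    also have "\<dots> \<le> 1/2 * norm u"
      using small[OF that] by (intro mult_right_mono) (auto simp: c_def dist_norm)
    finally have "norm (blinfun_apply (F (c t)) u - u) \<le> norm u / 2"
      by (simp add: blinfun.diff_left)
    then show ?thesis using norm_triangle_sub[of u "blinfun_apply (F (c t)) u"]
      by (simp add: norm_minus_commute)
  qed
  have Fc: "continuous_on {-e<..<e} (\<lambda>t. F (c t))"
    unfolding c_def using small
    by (intro continuous_on_compose2[OF Fg]) (auto intro!: continuous_intros)
  have Dcont: "continuous_on {-e<..<e} D"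
    unfolding continuous_on_def
  proof
    fix t assume t: "t \<in> {-e<..<e}"
    have "((\<lambda>s. F (c s)) \<longlongrightarrow> F (c t)) (at t within {-e<..<e})"
      using Fc t by (simp add: continuous_on_def)
    then have "((\<lambda>s. norm (F (c s) - F (c t))) \<longlongrightarrow> 0) (at t within {-e<..<e})"
      using tendsto_norm_zero LIM_zero by blast
    then have lim: "((\<lambda>s. 2 * (norm (F (c s) - F (c t)) * norm (D t))) \<longlongrightarrow> 2 * (0 * norm (D t))) (at t within {-e<..<e})"
      by (intro tendsto_intros)
    have "((\<lambda>s. D s - D t) \<longlongrightarrow> 0) (at t within {-e<..<e})"
    proof (rule Lim_null_comparison)
      show "\<forall>\<^sub>F s in at t within {-e<..<e}. norm (D s - D t) \<le> 2 * (norm (F (c s) - F (c t)) * norm (D t))"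
        unfolding eventually_at_filter
      proof (intro always_eventually allI impI)
        fix s assume s: "s \<in> {-e<..<e}"
        have "norm (D s - D t) \<le> 2 * norm (blinfun_apply (F (c s)) (D s - D t))"
          using low[of s] s by (simp add: abs_less_iff)
        also have "blinfun_apply (F (c s)) (D s - D t) = - blinfun_apply (F (c s) - F (c t)) (D t)"
          using FD[of s] FD[of t] s t by (simp add: blinfun.diff_right blinfun.diff_left abs_less_iff)
        finally show "norm (D s - D t) \<le> 2 * (norm (F (c s) - F (c t)) * norm (D t))"
          using norm_blinfun[of "F (c s) - F (c t)" "D t"] by simp
      qed
      show "((\<lambda>s. 2 * (norm (F (c s) - F (c t)) * norm (D t))) \<longlongrightarrow> 0) (at t within {-e<..<e})"
        using lim by simp
    qed
    then show "(D \<longlongrightarrow> D t) (at t within {-e<..<e})" by (rule LIM_zero_cancel)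
  qed
  have sol: "c t = x + t *\<^sub>R v - B (h (c t) - J x (c t - x))" if "\<bar>t\<bar> < e" for t
    using \<Phi>g[of "t *\<^sub>R v"] small[OF that] by (simp add: c_def \<Phi>_def algebra_simps)
  show thesis
  proof
    show "e > 0" by (rule e0)
    show "c C1_differentiable_on {-e<..<e}"
      unfolding C1_differentiable_on_def
      using cD Dcont by (intro exI[of _ D]) (auto simp: abs_less_iff)
    show "c 0 = x" by (simp add: c_def g0)
    have "D 0 = v" using FD[of 0] e0 by (simp add: c_def g0 Fx)
    then show "(c has_vector_derivative v) (at 0)" using cD[of 0] e0 by simp
    fix t assume t: "\<bar>t\<bar> < e"
    have "c t - x = t *\<^sub>R v - B (h (c t) - J x (c t - x))" using sol[OF t] by (simp add: algebra_simps)
    then have "J x (c t - x) = J x (t *\<^sub>R v - B (h (c t) - J x (c t - x)))" by simp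
    also have "\<dots> = - (h (c t) - J x (c t - x))"
      by (simp add: J.diff J.scaleR v JB)
    finally show "h (c t) = 0" by (simp add: algebra_simps)
    show "\<exists>w. c t = x + t *\<^sub>R v + B w"
      using sol[OF t] by (intro exI[of _ "- (h (c t) - J x (c t - x))"]) (simp only: B.neg, simp)
  qed
qed

lemma has_derivative_along_curve:
  assumes c: "curve_through S x v c" and F: "(F has_derivative F') (at x)"
  shows "((\<lambda>t. F (c t)) has_vector_derivative F' v) (at 0)"
proof -
  have c0: "c 0 = x" and cv: "(c has_vector_derivative v) (at 0)"
    using c unfolding curve_through_def by auto
  show ?thesis
    using F vector_derivative_diff_chain_within[of c v 0 UNIV F F'] cv c0
    by (auto simp: o_def intro: has_derivative_at_withinI)
qed

lemma curve_through_eventually: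
  assumes "curve_through S x v c"
  obtains e where "e > 0" "\<And>t. \<bar>t\<bar> < e \<Longrightarrow> c t \<in> S"
  using assms unfolding curve_through_def by (auto simp: abs_less_iff)

text \<open>
  Every equation that holds on a set can be differentiated along curves in it; all the necessary
  conditions on tangent vectors come from this.
\<close>

lemma curve_through_derivative_zero:
  assumes c: "curve_through S x v c" and S: "\<And>y. y \<in> S \<Longrightarrow> F y = 0"
    and F: "(F has_derivative F') (at x)"
  shows "F' v = 0"
proof -
  obtain e where e: "e > 0" "\<And>t. t \<in> {-e<..<e} \<Longrightarrow> c t \<in> S"
    using c unfolding curve_through_def by blast
  have "((\<lambda>t. F (c t)) has_vector_derivative F' v) (at 0)"
    by (rule has_derivative_along_curve[OF c F])
  moreover have "((\<lambda>t. F (c t)) has_vector_derivative 0) (at 0)"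
    by (rule has_vector_derivative_transform_within_open[of "\<lambda>_. 0" 0 0 "{-e<..<e}"])
      (use e S in auto)
  ultimately show ?thesis by (rule vector_derivative_unique_at)
qed

lemma tangent_space_level_set:
  fixes h :: "'a::euclidean_space \<Rightarrow> 'b::euclidean_space"
  assumes C1: "Ck 1 h" and x: "h x = 0" and surj: "surj (frechet_derivative h (at x))"
  shows "tangent_space {y. h y = 0} x = {v. frechet_derivative h (at x) v = 0}"
proof -
  have J: "(h has_derivative frechet_derivative h (at x)) (at x)"
    by (rule Ck_Suc_D(1)[of 0]) (use C1 in simp)
  obtain B where B: "linear B" "frechet_derivative h (at x) \<circ> B = id"
    using linear_surjective_right_inverse[OF has_derivative_linear[OF J] surj] by blast
  have JB: "frechet_derivative h (at x) (B w) = w" for w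
    using B(2) by (metis comp_apply id_apply)
  have "v \<in> tangent_space {y. h y = 0} x" if v: "frechet_derivative h (at x) v = 0" for v
  proof -
    obtain c e where "e > 0" "c C1_differentiable_on {-e<..<e}" "c 0 = x"
      "(c has_vector_derivative v) (at 0)" "\<And>t. \<bar>t\<bar> < e \<Longrightarrow> h (c t) = 0"
      using level_set_curve[OF C1 x B(1) JB v] by metis
    then show ?thesis
      unfolding tangent_space_def curve_through_def
      by (intro CollectI exI[of _ c] conjI exI[of _ e]) (auto simp: abs_less_iff)
  qed
  moreover have "frechet_derivative h (at x) v = 0" if v: "v \<in> tangent_space {y. h y = 0} x" for v
    using v curve_through_derivative_zero[OF _ _ J] unfolding tangent_space_def by blast
  ultimately show ?thesis by blast
qed

section \<open>Characterizing projections, gradients and Hessians\<close>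

text \<open>
  Just enough of an inner product to make an element of a subspace unique once its pairings with
  that subspace are given.
\<close>

definition definite_form :: "('a::real_vector \<Rightarrow> 'a \<Rightarrow> real) \<Rightarrow> bool" where
  "definite_form ip \<longleftrightarrow> (\<forall>x y s. ip (x - y) s = ip x s - ip y s) \<and> (\<forall>s. ip s s = 0 \<longrightarrow> s = 0)"

lemma definite_form_inner: "definite_form inner"
  by (simp add: definite_form_def inner_diff_left)

lemma definite_form_eqI:
  assumes "definite_form ip" "subspace T" "p \<in> T" "q \<in> T" "\<And>s. s \<in> T \<Longrightarrow> ip p s = ip q s"
  shows "p = q"
proof -
  have "p - q \<in> T" using assms by (simp add: subspace_diff)
  then have "ip (p - q) (p - q) = 0" using assms unfolding definite_form_def by simp
  then show ?thesis using assms(1) unfolding definite_form_def by (metis eq_iff_diff_eq_0)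
qed

lemma orth_proj_eqI:
  assumes ip: "definite_form ip" and T: "subspace T" and p: "p \<in> T" "\<And>s. s \<in> T \<Longrightarrow> ip (a - p) s = 0"
  shows "orth_proj ip T a = p"
  unfolding orth_proj_def
proof (rule the_equality)
  fix q assume q: "q \<in> T \<and> (\<forall>s\<in>T. ip (a - q) s = 0)"
  show "q = p"
    by (rule definite_form_eqI[OF ip T]) (use p q ip in \<open>auto simp: definite_form_def\<close>)
qed (use p in auto)

lemma orth_proj_inner:
  fixes T :: "'a::euclidean_space set"
  assumes T: "subspace T"
  shows "orth_proj inner T a \<in> T" "s \<in> T \<Longrightarrow> (a - orth_proj inner T a) \<bullet> s = 0"
proof -
  obtain y z where "y \<in> span T" "\<And>w. w \<in> span T \<Longrightarrow> orthogonal z w" "a = y + z"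
    using orthogonal_subspace_decomp_exists by blast
  then have y: "y \<in> T" "\<And>s. s \<in> T \<Longrightarrow> (a - y) \<bullet> s = 0"
    using T by (auto simp: orthogonal_def span_eq_iff[THEN iffD2])
  have "orth_proj inner T a = y"
    by (rule orth_proj_eqI[OF definite_form_inner T y])
  then show "orth_proj inner T a \<in> T" "s \<in> T \<Longrightarrow> (a - orth_proj inner T a) \<bullet> s = 0"
    using y by auto
qed

lemma has_derivative_egrad:
  fixes f :: "'a::euclidean_space \<Rightarrow> real"
  assumes "f differentiable at x"
  shows "egrad f x = (\<Sum>b\<in>Basis. frechet_derivative f (at x) b *\<^sub>R b)"
    and "(f has_derivative (\<lambda>u. egrad f x \<bullet> u)) (at x)"
proof -
  let ?g = "\<Sum>b\<in>Basis. frechet_derivative f (at x) b *\<^sub>R b"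
  have D: "(f has_derivative frechet_derivative f (at x)) (at x)"
    using assms by (simp add: frechet_derivative_works)
  have "frechet_derivative f (at x) u = u \<bullet> ?g" for u
  proof -
    have "frechet_derivative f (at x) u = (\<Sum>b\<in>Basis. (u \<bullet> b) * frechet_derivative f (at x) b)"
      using linear_sum[OF has_derivative_linear[OF D], of "\<lambda>b. (u \<bullet> b) *\<^sub>R b" Basis]
        linear_scale[OF has_derivative_linear[OF D]]
      by (simp add: euclidean_representation)
    then show ?thesis by (simp add: inner_sum_right mult.commute)
  qed
  then have G: "GDERIV f x :> ?g"
    unfolding gderiv_def by (intro has_derivative_eq_rhs[OF D] ext)
  have "egrad f x = ?g"
    unfolding egrad_def
  proof (rule the_equality[of "\<lambda>g. GDERIV f x :> g"])
    fix g assume "GDERIV f x :> g"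
    then have "(\<lambda>u. u \<bullet> g) = (\<lambda>u. u \<bullet> ?g)"
      using G has_derivative_unique unfolding gderiv_def by blast
    then show "g = ?g" by (metis vector_eq_ldot)
  qed (rule G)
  then show "egrad f x = ?g" "(f has_derivative (\<lambda>u. egrad f x \<bullet> u)) (at x)"
    using G unfolding gderiv_def by (auto simp: inner_commute)
qed

lemma differentiable_egrad:
  fixes f :: "'a::euclidean_space \<Rightarrow> real"
  assumes "Ck 2 f"
  shows "egrad f differentiable at x"
proof -
  have f: "Ck (Suc (Suc 0)) f" using assms by (simp add: numeral_2_eq_2)
  then have "egrad f = (\<lambda>x. \<Sum>b\<in>Basis. frechet_derivative f (at x) b *\<^sub>R b)"
    by (intro ext has_derivative_egrad(1)) simp
  moreover have "(\<lambda>x. frechet_derivative f (at x) b) differentiable at x" for b x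
    using f by simp
  ultimately show ?thesis by (auto intro!: differentiable_sum differentiable_scaleR)
qed

text \<open>
  Any tangent vector that represents the restriction of an ambient derivative is the
  gradient, by definiteness of the metric.
\<close>

lemma riem_grad_eqI:
  assumes ip: "definite_form ip" and T: "subspace (tangent_space M x)"
    and F: "(F has_derivative F') (at x)"
    and g: "g \<in> tangent_space M x" "\<And>v. v \<in> tangent_space M x \<Longrightarrow> F' v = ip g v"
  shows "riem_grad ip M F x = g"
  unfolding riem_grad_def
proof (rule the_equality)
  have D: "((\<lambda>t. F (c t)) has_real_derivative F' v) (at 0)" if "curve_through M x v c" for v c
    using has_derivative_along_curve[OF that F] by (simp add: has_real_derivative_iff_has_vector_derivative)
  show "g \<in> tangent_space M x \<and> (\<forall>v c. curve_through M x v c \<longrightarrow>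
      ((\<lambda>t. F (c t)) has_real_derivative ip g v) (at 0))"
    using g D unfolding tangent_space_def by fastforce
  fix q assume q: "q \<in> tangent_space M x \<and> (\<forall>v c. curve_through M x v c \<longrightarrow>
      ((\<lambda>t. F (c t)) has_real_derivative ip q v) (at 0))"
  show "q = g"
  proof (rule definite_form_eqI[OF ip T])
    fix s assume s: "s \<in> tangent_space M x"
    then obtain c where c: "curve_through M x s c" unfolding tangent_space_def by blast
    then have "ip q s = F' s" using q D[OF c] DERIV_unique by blast
    then show "ip q s = ip g s" using g(2)[OF s] by simp
  qed (use q g in auto)
qed

lemma riem_hess_eqI:
  assumes u: "u \<in> tangent_space M x"
    and w: "\<And>c. curve_through M x u c \<Longrightarrow>
      \<exists>D. ((\<lambda>t. riem_grad ip M F (c t)) has_vector_derivative D) (at 0) \<and>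
        orth_proj ip (tangent_space M x) D = w"
  shows "riem_hess ip M F x u = w"
  unfolding riem_hess_def
proof (rule the_equality)
  show "\<forall>c. curve_through M x u c \<longrightarrow>
      (\<exists>D. ((\<lambda>t. riem_grad ip M F (c t)) has_vector_derivative D) (at 0) \<and>
        w = orth_proj ip (tangent_space M x) D)" using w by metis
  fix q assume q: "\<forall>c. curve_through M x u c \<longrightarrow>
      (\<exists>D. ((\<lambda>t. riem_grad ip M F (c t)) has_vector_derivative D) (at 0) \<and>
        q = orth_proj ip (tangent_space M x) D)"
  obtain c where c: "curve_through M x u c" using u unfolding tangent_space_def by blast
  show "q = w" using q w[OF c] c vector_derivative_unique_at by metis
qed

section \<open>Gradient and Hessian on a level set\<close>

text \<open>
  The gradients of the components of \<open>h\<close> span the normal space of a level set. Subtracting from the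
  Euclidean gradient its part in their span, computed with the inverse Gram matrix, gives an
  expression for the Riemannian gradient that makes sense off the level set and can be
  differentiated in the ambient space.
\<close>

definition component_grad :: "('a::euclidean_space \<Rightarrow> real^'q) \<Rightarrow> 'a \<Rightarrow> 'q \<Rightarrow> 'a" where
  "component_grad h x k = (\<Sum>b\<in>Basis. (frechet_derivative h (at x) b $ k) *\<^sub>R b)"

definition gram :: "('a::euclidean_space \<Rightarrow> real^'q) \<Rightarrow> 'a \<Rightarrow> real^'q^'q" where
  "gram h x = (\<chi> k l. component_grad h x k \<bullet> component_grad h x l)"

definition projected_grad :: "('a::euclidean_space \<Rightarrow> real^'q) \<Rightarrow> ('a \<Rightarrow> real) \<Rightarrow> 'a \<Rightarrow> 'a" where
  "projected_grad h f x = egrad f x -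
     (\<Sum>k\<in>UNIV. (matrix_inv (gram h x) *v (\<chi> l. component_grad h x l \<bullet> egrad f x)) $ k *\<^sub>R component_grad h x k)"

lemma component_grad_inner:
  assumes "(h has_derivative frechet_derivative h (at x)) (at x)"
  shows "component_grad h x k \<bullet> u = frechet_derivative h (at x) u $ k"
proof -
  have lin: "linear (\<lambda>u. frechet_derivative h (at x) u $ k)"
    using bounded_linear_compose[OF bounded_linear_vec_nth has_derivative_bounded_linear[OF assms]]
    by (simp add: linear_conv_bounded_linear)
  have "frechet_derivative h (at x) u $ k = (\<Sum>b\<in>Basis. (u \<bullet> b) * (frechet_derivative h (at x) b $ k))"
    using linear_sum[OF lin, of "\<lambda>b. (u \<bullet> b) *\<^sub>R b" Basis] linear_scale[OF lin]
    by (simp add: euclidean_representation)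
  then show ?thesis
    by (simp add: component_grad_def inner_sum_left mult.commute inner_commute[of u])
qed

lemma invertible_gram:
  assumes h: "(h has_derivative frechet_derivative h (at x)) (at x)"
    and surj: "surj (frechet_derivative h (at x))"
  shows "invertible (gram h x)"
proof (rule invertible_if_ker)
  fix w assume w: "gram h x *v w = 0"
  let ?z = "\<Sum>l\<in>UNIV. w $ l *\<^sub>R component_grad h x l"
  have "(gram h x *v w) $ k = component_grad h x k \<bullet> ?z" for k
    by (simp add: gram_def matrix_vector_mult_def inner_sum_right mult.commute)
  then have "component_grad h x k \<bullet> ?z = 0" for k using w by simp
  then have "?z \<bullet> ?z = 0"
    by (metis (no_types, lifting) inner_scaleR_left inner_sum_left mult_zero_right sum.neutral)
  then have z: "?z = 0" by simp
  obtain u where u: "frechet_derivative h (at x) u = w" using surj by (metis surj_def)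
  have "w \<bullet> w = ?z \<bullet> u"
    by (simp add: inner_vec_def inner_sum_left component_grad_inner[OF h] u)
  then show "w = 0" using z by simp
qed

lemma projected_grad:
  assumes h: "(h has_derivative frechet_derivative h (at x)) (at x)"
    and surj: "surj (frechet_derivative h (at x))"
  shows "frechet_derivative h (at x) (projected_grad h f x) = 0"
    and "frechet_derivative h (at x) v = 0 \<Longrightarrow> (egrad f x - projected_grad h f x) \<bullet> v = 0"
proof -
  let ?b = "\<chi> l. component_grad h x l \<bullet> egrad f x"
  let ?w = "matrix_inv (gram h x) *v ?b"
  have eq: "gram h x *v ?w = ?b"
    using matrix_inv_mult[OF invertible_gram[OF h surj]] by (simp add: matrix_vector_mul_assoc)
  have "component_grad h x k \<bullet> projected_grad h f x = ?b $ k - (gram h x *v ?w) $ k" for k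
    by (simp add: projected_grad_def gram_def inner_diff_right inner_sum_right
        matrix_vector_mult_def[of "\<chi> k l. component_grad h x k \<bullet> component_grad h x l"] mult.commute)
  then show "frechet_derivative h (at x) (projected_grad h f x) = 0"
    by (simp add: vec_eq_iff component_grad_inner[OF h, symmetric] eq)
  assume "frechet_derivative h (at x) v = 0"
  then have "component_grad h x k \<bullet> v = 0" for k by (simp add: component_grad_inner[OF h])
  then show "(egrad f x - projected_grad h f x) \<bullet> v = 0"
    by (simp add: projected_grad_def inner_sum_left)
qed

lemma differentiable_projected_grad:
  fixes h :: "'a::euclidean_space \<Rightarrow> real^'q"
  assumes h2: "Ck 2 h" and f2: "Ck 2 f" and surj: "surj (frechet_derivative h (at x))"
  shows "projected_grad h f differentiable at x"
proof -
  have h: "Ck (Suc (Suc 0)) h" using h2 by (simp add: numeral_2_eq_2)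
  have hd: "(h has_derivative frechet_derivative h (at x)) (at x)" by (rule Ck_Suc_D(1)[OF h])
  have dir: "(\<lambda>x. frechet_derivative h (at x) b) differentiable at x" for b using h by simp
  have nth: "(\<lambda>y. F y $ k) differentiable at x" if F: "F differentiable at x" for F :: "'a \<Rightarrow> real^'q" and k
    using F unfolding differentiable_def
    by (blast intro: bounded_linear.has_derivative[OF bounded_linear_vec_nth])
  have cg: "(\<lambda>x. component_grad h x k) differentiable at x" for k
    unfolding component_grad_def
    by (intro differentiable_sum differentiable_scaleR ballI differentiable_const nth dir) auto
  have "gram h differentiable at x"
    unfolding differentiable_matrix_iff by (auto simp: gram_def intro!: differentiable_inner cg)
  then have inv: "(\<lambda>y. matrix_inv (gram h y)) differentiable at x"
    using invertible_gram[OF hd surj] by (rule differentiable_matrix_inv)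
  have eg: "egrad f differentiable at x" by (rule differentiable_egrad[OF f2])
  have "(\<lambda>y. matrix_inv (gram h y) $ k $ l) differentiable at x" for k l
    using inv unfolding differentiable_matrix_iff by blast
  then have "(\<lambda>y. (matrix_inv (gram h y) *v (\<chi> l. component_grad h y l \<bullet> egrad f y)) $ k) differentiable at x" for k
    by (simp add: matrix_vector_mult_def)
      (intro differentiable_sum ballI differentiable_mult differentiable_inner cg eg, auto)
  then show ?thesis
    unfolding projected_grad_def[abs_def]
    by (intro differentiable_diff eg differentiable_sum ballI differentiable_scaleR cg) auto
qed

lemma riem_grad_level_set:
  fixes h :: "'a::euclidean_space \<Rightarrow> real^'q"
  assumes h: "Ck 1 h" and f: "f differentiable at x" and x: "h x = 0"
    and surj: "surj (frechet_derivative h (at x))"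
  shows "riem_grad inner {y. h y = 0} f x = projected_grad h f x"
proof -
  have hd: "(h has_derivative frechet_derivative h (at x)) (at x)"
    by (rule Ck_Suc_D(1)[of 0]) (use h in simp)
  note T = tangent_space_level_set[OF h x surj]
  show ?thesis
  proof (rule riem_grad_eqI[OF definite_form_inner _ has_derivative_egrad(2)[OF f]])
    show "subspace (tangent_space {y. h y = 0} x)"
      unfolding T by (rule linear_subspace_kernel[OF has_derivative_linear[OF hd]])
    show "projected_grad h f x \<in> tangent_space {y. h y = 0} x"
      unfolding T using projected_grad(1)[OF hd surj] by blast
    show "egrad f x \<bullet> v = projected_grad h f x \<bullet> v" if "v \<in> tangent_space {y. h y = 0} x" for v
      using that projected_grad(2)[OF hd surj] unfolding T by (simp add: inner_diff_left)
  qed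
qed

text \<open>
  Along each curve the Riemannian gradient is the restriction of the ambient field
  \<open>projected_grad h f\<close>, so the derivative of that field at \<open>x\<close> serves for all curves with the same
  velocity.
\<close>

lemma riem_hess_level_set:
  fixes h :: "'a::euclidean_space \<Rightarrow> real^'q"
  assumes h: "Ck 2 h" and f: "Ck 2 f" and x: "h x = 0"
    and surj: "\<And>y. h y = 0 \<Longrightarrow> surj (frechet_derivative h (at y))"
    and u: "frechet_derivative h (at x) u = 0"
  shows "riem_hess inner {y. h y = 0} f x u =
    orth_proj inner {v. frechet_derivative h (at x) v = 0} (frechet_derivative (projected_grad h f) (at x) u)"
proof -
  have h1: "Ck 1 h" using h by (simp add: numeral_2_eq_2 differentiable_imp_continuous_on differentiable_on_def)
  have fd: "f differentiable at y" for y using f by (simp add: numeral_2_eq_2)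
  note T = tangent_space_level_set[OF h1 x surj[OF x]]
  show ?thesis
  proof (rule riem_hess_eqI)
    show "u \<in> tangent_space {y. h y = 0} x" unfolding T using u by simp
    fix c assume c: "curve_through {y. h y = 0} x u c"
    obtain e where e: "e > 0" "\<And>t. \<bar>t\<bar> < e \<Longrightarrow> c t \<in> {y. h y = 0}"
      using c curve_through_eventually by blast
    have "(projected_grad h f has_derivative frechet_derivative (projected_grad h f) (at x)) (at x)"
      using differentiable_projected_grad[OF h f surj[OF x]] by (simp add: frechet_derivative_works)
    from has_derivative_along_curve[OF c this]
    have "((\<lambda>t. riem_grad inner {y. h y = 0} f (c t)) has_vector_derivative
        frechet_derivative (projected_grad h f) (at x) u) (at 0)"
    proof (rule has_vector_derivative_transform_within_open[of _ _ _ "{-e<..<e}"])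
      fix t assume "t \<in> {-e<..<e}"
      then show "projected_grad h f (c t) = riem_grad inner {y. h y = 0} f (c t)"
        using e(2)[of t] riem_grad_level_set[OF h1 fd _ surj] by auto
    qed (use e in auto)
    then show "\<exists>D. ((\<lambda>t. riem_grad inner {y. h y = 0} f (c t)) has_vector_derivative D) (at 0) \<and>
        orth_proj inner (tangent_space {y. h y = 0} x) D =
        orth_proj inner {v. frechet_derivative h (at x) v = 0} (frechet_derivative (projected_grad h f) (at x) u)"
      unfolding T by blast
  qed
qed

section \<open>Orthogonally invariant level sets\<close>

text \<open>
  Padding with zero columns is right multiplication with \<open>P\<^sup>T\<close> for a frame \<open>P\<close> of coordinate vectors. An
  orthogonal matrix takes this frame to \<open>V\<close>, and \<open>h\<close> does not see the difference.
\<close>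

lemma level_set_r_eq:
  fixes h :: "real^'n^'m \<Rightarrow> real^'q" and V :: "real^'r^'n"
  assumes inj: "inj \<iota>" and h: "orth_invariant h" and V: "transpose V ** V = mat 1"
  shows "level_set_r \<iota> h = {H. h (H ** transpose V) = 0}"
proof -
  define P :: "real^'r^'n" where "P = (\<chi> j i. if j = \<iota> i then 1 else 0)"
  have pad: "pad \<iota> H = H ** transpose P" for H :: "real^'r^'m"
  proof -
    have "pad \<iota> H $ i $ j = (H ** transpose P) $ i $ j" for i j
    proof (cases "j \<in> range \<iota>")
      case True
      then obtain k where k: "j = \<iota> k" by blast
      have "(H ** transpose P) $ i $ j = H $ i $ k"
        by (simp add: matrix_matrix_mult_def P_def transpose_def k inj_eq[OF inj] if_distrib cong: if_cong)
      then show ?thesis using inj by (simp add: pad_def k)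
    next
      case False
      then have "(H ** transpose P) $ i $ j = 0"
        unfolding matrix_matrix_mult_def P_def transpose_def by (auto intro!: sum.neutral)
      with False show ?thesis by (simp add: pad_def)
    qed
    then show ?thesis by (simp add: vec_eq_iff)
  qed
  have "(transpose P ** P) $ i $ k = (mat 1 :: real^'r^'r) $ i $ k" for i k
  proof -
    have "(transpose P ** P) $ i $ k = (if i = k then 1 else 0)"
      by (simp add: matrix_matrix_mult_def P_def transpose_def inj_eq[OF inj] mult_delta_left)
    then show ?thesis by (simp add: mat_def)
  qed
  then have "transpose P ** P = mat 1" by (simp add: vec_eq_iff)
  then obtain Q where Q: "orthogonal_matrix Q" "Q ** P = V"
    using orthogonal_matrix_between_frames[OF _ V] by blast
  have "h (pad \<iota> H) = h (H ** transpose V)" for H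
  proof -
    have "H ** transpose V = (H ** transpose P) ** transpose Q"
      by (simp add: Q(2)[symmetric] matrix_transpose_mul matrix_mul_assoc)
    then show ?thesis using h Q(1) unfolding orth_invariant_def pad by simp
  qed
  then show ?thesis by (simp add: level_set_r_def)
qed

locale invariant_problem =
  fixes h :: "real^'n^'m \<Rightarrow> real^'q" and f :: "real^'n^'m \<Rightarrow> real" and \<omega> :: real
  assumes h2: "Ck 2 h" and f2: "Ck 2 f" and inv: "orth_invariant h" and \<omega>: "\<omega> > 0"
    and surj: "\<And>Y. h Y = 0 \<Longrightarrow> surj (frechet_derivative h (at Y))"
begin

abbreviation J where "J X \<equiv> frechet_derivative h (at X)"

lemma h1: "Ck 1 h"
  using h2 by (simp add: numeral_2_eq_2 differentiable_imp_continuous_on differentiable_on_def)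

lemma J: "(h has_derivative J X) (at X)"
  by (rule Ck_Suc_D(1)[of 0]) (use h1 in simp)

lemma J_linear: "linear (J X)"
  using J by (rule has_derivative_linear)

lemmas J_simps = linear_add[OF J_linear] linear_diff[OF J_linear] linear_neg[OF J_linear]
  linear_0[OF J_linear] linear_scale[OF J_linear]

lemma invD: "orthogonal_matrix Q \<Longrightarrow> h (Y ** Q) = h Y"
  using inv by (simp add: orth_invariant_def)

text \<open>
  The reflection \<open>I - 2G\<close> fixes \<open>X\<close> and sends \<open>L ** G\<close> to its negative, while it leaves \<open>h\<close>
  invariant. So the differential takes opposite and equal values on this direction.
\<close>

lemma J_kernel:
  assumes G: "transpose G = G" "G ** G = G" and X: "X ** G = 0"
  shows "J X (L ** G) = 0"
proof -
  define Q where "Q = mat 1 - (G + G)"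
  have "orthogonal_matrix Q"
    by (simp only: orthogonal_matrix Q_def mat_simps G matrix_mul_lid matrix_mul_rid transpose_mat)
      (simp add: algebra_simps)
  then have hQ: "(\<lambda>Y. h (Y ** Q)) = h" by (simp add: invD)
  have XQ: "X ** Q = X" by (simp only: Q_def mat_simps X matrix_mul_rid) simp
  have "((\<lambda>Y. h (Y ** Q)) has_derivative (\<lambda>L. J (X ** Q) (L ** Q))) (at X)"
    using diff_chain_at[OF bounded_linear.has_derivative[OF matmul.bounded_linear_left has_derivative_ident] J]
    by (simp add: o_def)
  then have "(h has_derivative (\<lambda>L. J X (L ** Q))) (at X)" by (simp add: hQ XQ)
  then have "J X = (\<lambda>L. J X (L ** Q))" using J has_derivative_unique by blast
  then have "J X (L ** G) = J X (L ** G ** Q)" by metis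
  also have "L ** G ** Q = - (L ** G)"
    by (simp only: Q_def mat_simps G matrix_mul_rid) (simp add: algebra_simps)
  also have "J X (- (L ** G)) = - J X (L ** G)" by (rule linear_neg[OF J_linear])
  finally have "J X (L ** G) + J X (L ** G) = 0" by (simp only: eq_neg_iff_add_eq_0)
  then have "(2::real) *\<^sub>R J X (L ** G) = 0" by (simp only: scaleR_2)
  then show ?thesis by (simp only: scaleR_eq_0_iff) simp
qed

text \<open>
  Any right inverse of \<open>J X\<close> stays one when its values are multiplied by \<open>I - G\<close>. With this choice
  the correction terms of the curve are annihilated by \<open>G\<close>, as are \<open>X\<close> and \<open>Y\<close>.
\<close>

lemma curve_fixing_kernel:
  assumes G: "transpose G = G" "G ** G = G" and X: "X ** G = 0" "h X = 0"
    and Y: "J X Y = 0" "Y ** G = 0"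
  obtains c e where "e > 0" "c C1_differentiable_on {-e<..<e}" "c 0 = X"
    "(c has_vector_derivative Y) (at 0)"
    "\<And>t. \<bar>t\<bar> < e \<Longrightarrow> h (c t) = 0" "\<And>t. \<bar>t\<bar> < e \<Longrightarrow> c t ** G = 0"
proof -
  obtain B where B: "linear B" "J X \<circ> B = id"
    using linear_surjective_right_inverse[OF J_linear surj[OF X(2)]] by blast
  define B' where "B' w = B w - B w ** G" for w
  have "linear B'"
    unfolding B'_def
    by (intro linear_compose_sub B linear_compose[OF B(1), unfolded o_def]
        bounded_linear.linear matmul.bounded_linear_left)
  moreover have "J X (B' w) = w" for w
    using B(2) J_kernel[OF G X(1)] by (simp add: B'_def J_simps pointfree_idE)
  ultimately obtain c e where c: "e > 0" "c C1_differentiable_on {-e<..<e}" "c 0 = X"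
    "(c has_vector_derivative Y) (at 0)" "\<And>t. \<bar>t\<bar> < e \<Longrightarrow> h (c t) = 0"
    "\<And>t. \<bar>t\<bar> < e \<Longrightarrow> \<exists>w. c t = X + t *\<^sub>R Y + B' w"
    using level_set_curve[OF h1 X(2) _ _ Y(1), of B'] by metis
  have "c t ** G = 0" if t: "\<bar>t\<bar> < e" for t
  proof -
    obtain w where "c t = X + t *\<^sub>R Y + B' w" using c(6)[OF t] by blast
    then show ?thesis by (simp add: B'_def mat_simps G X Y)
  qed
  with c show thesis using that by blast
qed

text \<open>
  A curve in the level set that stays annihilated by \<open>G = I - VV\<^sup>T\<close> equals \<open>(c(t) V) V\<^sup>T\<close>, hence
  \<open>c(t) V\<close> is a curve in the level set of narrow matrices.
\<close>

lemma tangent_space_level_set_r: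
  assumes inj: "inj \<iota>" and V: "transpose V ** V = mat 1" and H: "H \<in> level_set_r \<iota> h"
  shows "tangent_space (level_set_r \<iota> h) H = {K. J (H ** transpose V) (K ** transpose V) = 0}"
proof (intro equalityI subsetI CollectI)
  note eq = level_set_r_eq[OF inj inv V]
  have hX: "h (H ** transpose V) = 0" using H eq by blast
  fix K
  { assume "K \<in> tangent_space (level_set_r \<iota> h) H"
    then obtain c where c: "curve_through (level_set_r \<iota> h) H K c" unfolding tangent_space_def by blast
    have "((\<lambda>H. h (H ** transpose V)) has_derivative (\<lambda>K. J (H ** transpose V) (K ** transpose V))) (at H)"
      using diff_chain_at[OF bounded_linear.has_derivative[OF matmul.bounded_linear_left has_derivative_ident] J]
      by (simp add: o_def)
    then show "J (H ** transpose V) (K ** transpose V) = 0"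
      by (rule curve_through_derivative_zero[OF c, rotated]) (use eq in blast) }
  assume K: "K \<in> {K. J (H ** transpose V) (K ** transpose V) = 0}"
  define G where "G = mat 1 - V ** transpose V"
  have VG: "transpose V ** G = 0" by (simp add: G_def mat_simps mult_chain[OF V])
  have G: "transpose G = G" "G ** G = G"
    by (simp_all add: G_def mat_simps mult_chain[OF V])
  have XG: "H ** transpose V ** G = 0" and YG: "K ** transpose V ** G = 0"
    by (simp_all add: mat_simps VG)
  obtain c e where c: "e > 0" "c C1_differentiable_on {-e<..<e}" "c 0 = H ** transpose V"
    "(c has_vector_derivative K ** transpose V) (at 0)"
    "\<And>t. \<bar>t\<bar> < e \<Longrightarrow> h (c t) = 0" "\<And>t. \<bar>t\<bar> < e \<Longrightarrow> c t ** G = 0"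
    using K by (auto intro: curve_fixing_kernel[OF G XG hX _ YG])
  have "curve_through (level_set_r \<iota> h) H K (\<lambda>t. c t ** V)"
    unfolding curve_through_def
  proof (intro conjI exI[of _ e] ballI)
    show "e > 0" by (rule c)
    show "(\<lambda>t. c t ** V) C1_differentiable_on {-e<..<e}"
      by (intro C1_differentiable_on_matrix_mult c C1_differentiable_on_const)
    show "c 0 ** V = H" by (simp add: c mat_simps V)
    show "((\<lambda>t. c t ** V) has_vector_derivative K) (at 0)"
      using bounded_linear.has_vector_derivative[OF matmul.bounded_linear_left c(4), of V]
      by (simp add: mat_simps V)
    fix t assume "t \<in> {-e<..<e}"
    then have t: "\<bar>t\<bar> < e" by (simp add: abs_less_iff)
    have "c t ** V ** transpose V = c t" using c(6)[OF t] by (simp add: G_def mat_simps)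
    then show "c t ** V \<in> level_set_r \<iota> h" using c(5)[OF t] eq by simp
  qed
  then show "K \<in> tangent_space (level_set_r \<iota> h) H" unfolding tangent_space_def by blast
qed

end

section \<open>The tangent space of the decoupled manifold\<close>

text \<open>
  The tangent space in a form that refers to the point \<open>(X, G)\<close> only, and not to a frame \<open>V\<close>. This
  is what allows the gradient to be written down and differentiated along a curve without
  choosing frames along it.
\<close>

definition Mh_tangent ::
  "(real^'n^'m \<Rightarrow> real^'q) \<Rightarrow> real^'n^'m \<Rightarrow> real^'n^'n \<Rightarrow> ((real^'n^'m) \<times> (real^'n^'n)) set" where
  "Mh_tangent h X G = {(Y + X ** transpose A, - (A + transpose A)) | Y A.
     frechet_derivative h (at X) Y = 0 \<and> Y ** G = 0 \<and> G ** A = A \<and> A ** G = 0}"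

lemma Mh_D:
  assumes "(X, G) \<in> Mh TYPE('r::finite) h"
  shows "transpose G = G" "G ** G = G" "X ** G = 0" "h X = 0"
  using assms by (auto simp: Mh_def Gr_def)

context invariant_problem begin

lemma subspace_Mh_tangent: "subspace (Mh_tangent h X G)"
  unfolding subspace_def
proof (intro conjI ballI allI)
  show "0 \<in> Mh_tangent h X G"
    unfolding Mh_tangent_def
    by (intro CollectI exI[of _ 0]) (simp add: mat_simps J_simps zero_prod_def)
  fix x y assume "x \<in> Mh_tangent h X G" "y \<in> Mh_tangent h X G"
  then obtain Y A Y' A' where x: "x = (Y + X ** transpose A, - (A + transpose A))"
      "J X Y = 0" "Y ** G = 0" "G ** A = A" "A ** G = 0"
    and y: "y = (Y' + X ** transpose A', - (A' + transpose A'))"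
      "J X Y' = 0" "Y' ** G = 0" "G ** A' = A'" "A' ** G = 0"
    unfolding Mh_tangent_def by blast
  show "x + y \<in> Mh_tangent h X G"
    unfolding Mh_tangent_def
    by (intro CollectI exI[of _ "Y + Y'"] exI[of _ "A + A'"]) (simp add: x y mat_simps J_simps)
next
  fix c x assume "x \<in> Mh_tangent h X G"
  then obtain Y A where x: "x = (Y + X ** transpose A, - (A + transpose A))"
      "J X Y = 0" "Y ** G = 0" "G ** A = A" "A ** G = 0"
    unfolding Mh_tangent_def by blast
  show "c *\<^sub>R x \<in> Mh_tangent h X G"
    unfolding Mh_tangent_def
    by (intro CollectI exI[of _ "c *\<^sub>R Y"] exI[of _ "c *\<^sub>R A"])
      (simp add: x mat_simps J_simps algebra_simps)
qed

text \<open>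
  From \<open>G\<^sup>2 = G\<close> the velocity of \<open>G\<close> is off-diagonal with respect to \<open>G\<close>, which gives \<open>A = -G\<zeta>\<close>.
  Conversely, with \<open>\<Omega> = A - A\<^sup>T\<close> the commutator of \<open>\<Omega>\<close> and \<open>G\<close> is \<open>-(A + A\<^sup>T)\<close>, so conjugating \<open>G\<close> by the
  Cayley transform produces the second component, and undoing the rotation on the first
  component adds \<open>XA\<^sup>T\<close> to its velocity.
\<close>

lemma tangent_space_Mh:
  assumes p: "(X, G) \<in> Mh TYPE('r::finite) h"
  shows "tangent_space (Mh TYPE('r) h) (X, G) = Mh_tangent h X G"
proof (intro equalityI subsetI)
  note G = Mh_D(1,2)[OF p] and X = Mh_D(3,4)[OF p]
  fix v assume "v \<in> tangent_space (Mh TYPE('r) h) (X, G)"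
  moreover obtain \<eta> \<zeta> where v: "v = (\<eta>, \<zeta>)" by (cases v)
  ultimately obtain c where c: "curve_through (Mh TYPE('r) h) (X, G) (\<eta>, \<zeta>) c"
    unfolding tangent_space_def by blast
  have dfst: "(fst has_derivative fst) (at (X, G))" and dsnd: "(snd has_derivative snd) (at (X, G))"
    by (auto intro!: derivative_intros bounded_linear_imp_has_derivative bounded_linear_fst bounded_linear_snd)
  have "transpose \<zeta> - \<zeta> = 0"
    using curve_through_derivative_zero[OF c, of "\<lambda>p. transpose (snd p) - snd p"
        "\<lambda>p. transpose (snd p) - snd p"]
    by (force intro!: has_derivative_diff bounded_linear.has_derivative[OF bounded_linear_transpose] dsnd dest: Mh_D)
  then have sym: "transpose \<zeta> = \<zeta>" by simp
  have "G ** \<zeta> + \<zeta> ** G - \<zeta> = 0"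
    using curve_through_derivative_zero[OF c, of "\<lambda>p. snd p ** snd p - snd p"
        "\<lambda>u. G ** snd u + snd u ** G - snd u"]
      has_derivative_diff[OF matmul.FDERIV[OF dsnd dsnd] dsnd]
    by (force dest: Mh_D)
  then have \<zeta>: "\<zeta> = G ** \<zeta> + \<zeta> ** G" by simp
  have X\<zeta>: "X ** \<zeta> + \<eta> ** G = 0"
    using curve_through_derivative_zero[OF c, of "\<lambda>p. fst p ** snd p"
        "\<lambda>u. X ** snd u + fst u ** G"] matmul.FDERIV[OF dfst dsnd]
    by (force dest: Mh_D)
  have "J X \<eta> = 0"
    using curve_through_derivative_zero[OF c, of "\<lambda>p. h (fst p)" "\<lambda>u. J X (fst u)"]
      diff_chain_at[OF dfst, of h "J X"] J
    by (force dest: Mh_D simp: o_def)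
  then have J\<eta>: "J X (\<eta> - \<eta> ** G) = 0" by (simp add: J_simps J_kernel[OF G X(1)])
  have "G ** \<zeta> = G ** (G ** \<zeta> + \<zeta> ** G)" using \<zeta> by simp
  then have GZG: "G ** (\<zeta> ** G) = 0" by (simp add: mat_simps mult_chain[OF G(2)])
  define A where "A = - (G ** \<zeta>)"
  have At: "transpose A = - (\<zeta> ** G)" by (simp add: A_def mat_simps G sym)
  have "v = ((\<eta> - \<eta> ** G) + X ** transpose A, - (A + transpose A))"
  proof -
    have "X ** (\<zeta> ** G) + \<eta> ** G = 0"
      using arg_cong[OF X\<zeta>, of "\<lambda>Z. Z ** G"] by (simp add: mat_simps G)
    then have "X ** transpose A = \<eta> ** G" by (simp add: At mat_simps neg_eq_iff_add_eq_0 add.commute)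
    then show ?thesis using \<zeta> by (simp add: v At) (simp add: A_def add.commute)
  qed
  moreover have "(\<eta> - \<eta> ** G) ** G = 0" "G ** A = A" "A ** G = 0"
    by (simp_all add: A_def mat_simps G mult_chain[OF G(2)] GZG)
  ultimately show "v \<in> Mh_tangent h X G"
    unfolding Mh_tangent_def using J\<eta> by blast
next
  note G = Mh_D(1,2)[OF p] and X = Mh_D(3,4)[OF p]
  fix v assume "v \<in> Mh_tangent h X G"
  then obtain Y A where v: "v = (Y + X ** transpose A, - (A + transpose A))"
      and Y: "J X Y = 0" "Y ** G = 0" and A: "G ** A = A" "A ** G = 0"
    unfolding Mh_tangent_def by blast
  obtain c e where c: "e > 0" "c C1_differentiable_on {-e<..<e}" "c 0 = X"
    "(c has_vector_derivative Y) (at 0)"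
    "\<And>t. \<bar>t\<bar> < e \<Longrightarrow> h (c t) = 0" "\<And>t. \<bar>t\<bar> < e \<Longrightarrow> c t ** G = 0"
    by (rule curve_fixing_kernel[OF G X Y]) (rule that)
  define \<Omega> where "\<Omega> = A - transpose A"
  have "transpose \<Omega> = - \<Omega>" by (simp add: \<Omega>_def transpose_linear)
  then obtain Q where Q: "\<And>t. orthogonal_matrix (Q t)" "Q 0 = mat 1"
    "(Q has_vector_derivative \<Omega>) (at 0)" "\<And>S. Q C1_differentiable_on S"
    using cayley_curve by blast
  have QQ: "transpose (Q t) ** Q t = mat 1" for t using Q(1) by (simp add: orthogonal_matrix)
  have At: "transpose A ** G = transpose A" "G ** transpose A = 0"
    using arg_cong[OF A(1), of transpose] arg_cong[OF A(2), of transpose]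
    by (simp_all add: mat_simps G)
  have XA: "X ** A = 0" using A(1) X(1) by (metis matrix_mul_assoc matmul.zero_left)
  define p where "p t = (c t ** transpose (Q t), Q t ** G ** transpose (Q t))" for t
  have dQt: "((\<lambda>t. transpose (Q t)) has_vector_derivative transpose \<Omega>) (at 0)"
    by (rule bounded_linear.has_vector_derivative[OF bounded_linear_transpose Q(3)])
  have dQG: "((\<lambda>t. Q t ** G) has_vector_derivative \<Omega> ** G) (at 0)"
    by (rule bounded_linear.has_vector_derivative[OF matmul.bounded_linear_left Q(3)])
  have "curve_through (Mh TYPE('r) h) (X, G) v p"
    unfolding curve_through_def
  proof (intro conjI exI[of _ e] ballI)
    show "e > 0" by (rule c)
    have "(\<lambda>t. c t ** transpose (Q t)) C1_differentiable_on {-e<..<e}"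
      "(\<lambda>t. Q t ** G ** transpose (Q t)) C1_differentiable_on {-e<..<e}"
      by (intro C1_differentiable_on_matrix_mult C1_differentiable_on_bounded_linear[OF bounded_linear_transpose]
          c Q C1_differentiable_on_const)+
    then obtain D1 D2 where
      D1: "\<And>t. t \<in> {-e<..<e} \<Longrightarrow> ((\<lambda>t. c t ** transpose (Q t)) has_vector_derivative D1 t) (at t)"
        "continuous_on {-e<..<e} D1" and
      D2: "\<And>t. t \<in> {-e<..<e} \<Longrightarrow> ((\<lambda>t. Q t ** G ** transpose (Q t)) has_vector_derivative D2 t) (at t)"
        "continuous_on {-e<..<e} D2"
      unfolding C1_differentiable_on_def by blast
    show "p C1_differentiable_on {-e<..<e}"
      unfolding C1_differentiable_on_def p_def
      by (intro exI[of _ "\<lambda>t. (D1 t, D2 t)"] conjI ballI has_vector_derivative_Pair continuous_on_Pair D1 D2)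
    show "p 0 = (X, G)" by (simp add: p_def c Q)
    have "(p has_vector_derivative (c 0 ** transpose \<Omega> + Y ** transpose (Q 0),
        (Q 0 ** G) ** transpose \<Omega> + (\<Omega> ** G) ** transpose (Q 0))) (at 0)"
      unfolding p_def
      by (intro has_vector_derivative_Pair matmul.has_vector_derivative c(4) dQt dQG)
    then show "(p has_vector_derivative v) (at 0)"
      by (simp add: c Q v \<Omega>_def mat_simps A At XA algebra_simps)
    fix t assume "t \<in> {-e<..<e}"
    then have t: "\<bar>t\<bar> < e" by (simp add: abs_less_iff)
    have "h (c t ** transpose (Q t)) = 0"
      using c(5)[OF t] invD[of "transpose (Q t)"] Q(1) by simp
    moreover have "rank (Q t ** G ** transpose (Q t)) = CARD('n) - CARD('r)"
      using p rank_orthogonal_conjugate[OF Q(1)] by (simp add: Mh_def Gr_def)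
    ultimately show "p t \<in> Mh TYPE('r) h"
      unfolding Mh_def Gr_def p_def
      by (simp add: mat_simps G mult_chain[OF QQ] mult_chain[OF G(2)] mult_chain[OF c(6)[OF t]])
  qed
  then show "v \<in> tangent_space (Mh TYPE('r) h) (X, G)" unfolding tangent_space_def by blast
qed

end

section \<open>The gradient on the decoupled manifold\<close>

lemma definite_form_ip_omega:
  assumes "\<omega> > 0"
  shows "definite_form (ip_omega \<omega>)"
  unfolding definite_form_def
proof (intro conjI allI impI)
  show "ip_omega \<omega> (x - y) s = ip_omega \<omega> x s - ip_omega \<omega> y s" for x y s
    by (simp add: ip_omega_def inner_diff_left algebra_simps)
  fix s assume "ip_omega \<omega> s s = 0"
  then have "fst s \<bullet> fst s + \<omega> * (snd s \<bullet> snd s) = 0" by (simp add: ip_omega_def)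
  moreover have "0 \<le> fst s \<bullet> fst s" "0 \<le> \<omega> * (snd s \<bullet> snd s)" using assms by auto
  ultimately have "fst s \<bullet> fst s = 0" "\<omega> * (snd s \<bullet> snd s) = 0" by linarith+
  then show "s = 0" using assms by (simp add: prod_eq_iff)
qed

lemma M_mat_eq: "M_mat \<omega> X = (2 * \<omega>) *\<^sub>R mat 1 + transpose X ** X"
  by (simp add: M_mat_def vec_eq_iff mat_def)

lemma invertible_M_mat:
  assumes "\<omega> > 0"
  shows "invertible (M_mat \<omega> X)"
proof (rule invertible_if_ker)
  fix v assume "M_mat \<omega> X *v v = 0"
  then have "0 = v \<bullet> (M_mat \<omega> X *v v)" by simp
  also have "\<dots> = 2 * \<omega> * (v \<bullet> v) + (X *v v) \<bullet> (X *v v)"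
    by (simp add: M_mat_eq matrix_vector_mult_add_rdistrib inner_add_right inner_matrix_vector
        scaleR_matrix_vector_assoc[symmetric] matrix_vector_mul_assoc del: transpose_matrix_vector)
  finally have "2 * \<omega> * (v \<bullet> v) + (X *v v) \<bullet> (X *v v) = 0" by simp
  moreover have "0 \<le> 2 * \<omega> * (v \<bullet> v)" "0 \<le> (X *v v) \<bullet> (X *v v)" using assms by auto
  ultimately have "2 * \<omega> * (v \<bullet> v) = 0" by linarith
  then show "v = 0" using assms by simp
qed

lemmas M_mat_inv = matrix_inv_mult[OF invertible_M_mat]

lemma transpose_M_mat_inv:
  assumes "\<omega> > 0"
  shows "transpose (matrix_inv (M_mat \<omega> X)) = matrix_inv (M_mat \<omega> X)"
proof -
  let ?N = "matrix_inv (M_mat \<omega> X)"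
  have "transpose (M_mat \<omega> X) = M_mat \<omega> X" by (simp add: M_mat_eq mat_simps)
  then have "M_mat \<omega> X ** transpose ?N = mat 1"
    using arg_cong[OF M_mat_inv(2)[OF assms, of X], of transpose] by (simp add: matrix_transpose_mul)
  then have "?N ** (M_mat \<omega> X ** transpose ?N) = ?N" by simp
  then show ?thesis by (simp add: mult_chain[OF M_mat_inv(2)[OF assms]])
qed

text \<open>
  The columns of \<open>G\<close> lie in the kernel of \<open>X\<close>, so they are eigenvectors of \<open>M_mat \<omega> X\<close> for the eigenvalue \<open>2\<omega>\<close>.
\<close>

lemma M_mat_kernel:
  fixes X :: "real^'n^'m" and G :: "real^'n^'n"
  assumes \<omega>: "\<omega> > 0" and X: "X ** G = 0"
  shows "matrix_inv (M_mat \<omega> X) ** G = (1 / (2 * \<omega>)) *\<^sub>R G"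
proof -
  have "M_mat \<omega> X ** G = (2 * \<omega>) *\<^sub>R G" by (simp add: M_mat_eq mat_simps X)
  then have "matrix_inv (M_mat \<omega> X) ** (M_mat \<omega> X ** G) = (2 * \<omega>) *\<^sub>R (matrix_inv (M_mat \<omega> X) ** G)"
    by (simp add: mult_distrib)
  then have "G = (2 * \<omega>) *\<^sub>R (matrix_inv (M_mat \<omega> X) ** G)"
    by (simp add: mult_chain[OF M_mat_inv(2)[OF \<omega>]])
  then have "(1 / (2 * \<omega>)) *\<^sub>R G = (1 / (2 * \<omega>)) *\<^sub>R ((2 * \<omega>) *\<^sub>R (matrix_inv (M_mat \<omega> X) ** G))"
    by (rule arg_cong)
  then show ?thesis using \<omega> by simp
qed

context invariant_problem begin

abbreviation pgrad where "pgrad \<equiv> projected_grad h f"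

text \<open>
  The difference \<open>\<nu>\<close> of the two gradients is orthogonal to the kernel of \<open>J X\<close>, and \<open>\<nu>G\<close> lies in this
  kernel; thus \<open>\<nu>G \<bullet> \<nu>G = \<nu> \<bullet> \<nu>G = 0\<close>.
\<close>

lemma normal_part_kernel:
  assumes G: "transpose G = G" "G ** G = G" and X: "X ** G = 0" "h X = 0"
  shows "egrad f X ** G = pgrad X ** G"
proof -
  let ?\<nu> = "egrad f X - pgrad X"
  have "?\<nu> \<bullet> (?\<nu> ** G) = 0"
    by (rule projected_grad(2)[OF J surj[OF X(2)]]) (rule J_kernel[OF G X(1)])
  then have "(?\<nu> ** G) \<bullet> (?\<nu> ** G) = 0"
    by (simp only: inner_mult_right[of ?\<nu> G "?\<nu> ** G"] G matrix_mul_assoc[symmetric])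
  then have "?\<nu> ** G = 0" by simp
  then show ?thesis by (simp add: mult_distrib)
qed

text \<open>
  The orthogonal projection onto the tangent space splits: \<open>Y\<close> is determined by \<open>E\<close> alone, and the
  off-diagonal part \<open>C\<close> solves a linear equation with matrix \<open>M_mat \<omega> X\<close>. The term \<open>X\<^sup>TX\<close> of this matrix
  comes from the pairing of the first components, and \<open>2\<omega>I\<close> from the symmetrized second components,
  where \<open>C\<close> and \<open>A\<^sup>T\<close> are orthogonal. The lemma is used both for the gradient (\<open>Z = 0\<close>) and for the
  Hessian.
\<close>

lemma ip_omega_residual:
  assumes G: "transpose G = G" "G ** G = G" and X: "X ** G = 0" and Z: "transpose Z = Z"
    and Y: "J X Y = 0" "Y ** G = 0" and C: "G ** C = C" "C ** G = 0"
    and perp: "\<And>Y'. J X Y' = 0 \<Longrightarrow> Y' ** G = 0 \<Longrightarrow> (E - Y) \<bullet> Y' = 0"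
    and CM: "C ** M_mat \<omega> X = G ** (transpose E ** X - (2 * \<omega>) *\<^sub>R Z) ** (mat 1 - G)"
    and s: "s \<in> Mh_tangent h X G"
  shows "ip_omega \<omega> ((E, Z) - (Y + X ** transpose C, - (C + transpose C))) s = 0"
proof -
  obtain Y' A where s: "s = (Y' + X ** transpose A, - (A + transpose A))"
    and Y': "J X Y' = 0" "Y' ** G = 0" and A: "G ** A = A" "A ** G = 0"
    using s unfolding Mh_tangent_def by blast
  have t: "transpose B ** G = transpose B" if "G ** B = B" for B
    using arg_cong[OF that, of transpose] by (simp add: matrix_transpose_mul G)
  have tA: "G ** transpose A = 0"
    using arg_cong[OF A(2), of transpose] by (simp add: matrix_transpose_mul G transpose_linear)
  have off: "(X ** transpose B) \<bullet> L = 0" if "G ** B = B" "L ** G = 0" for B L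
  proof -
    have "(X ** transpose B) \<bullet> L = (X ** transpose B ** G) \<bullet> L"
      by (simp add: matrix_mul_assoc[symmetric] t[OF that(1)])
    also have "\<dots> = (X ** transpose B) \<bullet> (L ** G)" by (simp only: inner_mult_right G)
    finally show ?thesis by (simp add: that)
  qed
  have EA: "E \<bullet> (X ** transpose A) = (transpose E ** X) \<bullet> A"
  proof -
    have "E \<bullet> (X ** transpose A) = transpose A \<bullet> (transpose X ** E)"
      by (simp only: inner_commute[of E] inner_mult_left)
    also have "\<dots> = A \<bullet> transpose (transpose X ** E)" by (metis inner_transpose transpose_transpose)
    finally show ?thesis by (simp only: matrix_transpose_mul transpose_transpose inner_commute)
  qed
  have CA: "(X ** transpose C) \<bullet> (X ** transpose A) = (C ** (transpose X ** X)) \<bullet> A"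
  proof -
    have "(X ** transpose C) \<bullet> (X ** transpose A) = transpose (X ** transpose C) \<bullet> transpose (X ** transpose A)"
      by (simp only: inner_transpose)
    also have "\<dots> = (A ** transpose X) \<bullet> (C ** transpose X)"
      by (simp only: matrix_transpose_mul transpose_transpose inner_commute)
    also have "\<dots> = (C ** (transpose X ** X)) \<bullet> A"
      by (simp only: inner_mult_right transpose_transpose matrix_mul_assoc inner_commute)
    finally show ?thesis .
  qed
  have cross: "C \<bullet> transpose A = 0"
  proof -
    have "C \<bullet> transpose A = (G ** C) \<bullet> transpose A" by (simp only: C)
    also have "\<dots> = C \<bullet> (G ** transpose A)" by (simp only: inner_mult_left G)
    finally show ?thesis by (simp add: tA)
  qed
  have cross': "transpose C \<bullet> A = 0"
    using cross by (metis inner_transpose transpose_transpose)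
  have CtAt: "transpose C \<bullet> transpose A = C \<bullet> A" and ZAt: "Z \<bullet> transpose A = Z \<bullet> A"
    using inner_transpose[of C A] inner_transpose[of Z A] by (simp_all add: Z)
  let ?R = "transpose E ** X - (2 * \<omega>) *\<^sub>R Z"
  have "(C ** M_mat \<omega> X) \<bullet> A = ?R \<bullet> A"
  proof -
    have "(C ** M_mat \<omega> X) \<bullet> A = (G ** ?R) \<bullet> (A ** transpose (mat 1 - G))"
      by (simp only: CM inner_mult_right)
    also have "A ** transpose (mat 1 - G) = A"
      by (simp add: mat_simps G A)
    also have "(G ** ?R) \<bullet> A = ?R \<bullet> A" by (simp only: inner_mult_left G A)
    finally show ?thesis .
  qed
  then have key: "2 * \<omega> * (C \<bullet> A) + (C ** (transpose X ** X)) \<bullet> A = (transpose E ** X) \<bullet> A - 2 * \<omega> * (Z \<bullet> A)"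
    by (simp add: M_mat_eq mult_distrib inner_add_left inner_diff_left)
  have YA: "Y \<bullet> (X ** transpose A) = 0"
    using off[OF A(1) Y(2)] by (simp add: inner_commute)
  have "ip_omega \<omega> ((E, Z) - (Y + X ** transpose C, - (C + transpose C))) s =
      (E - Y) \<bullet> Y' - (X ** transpose C) \<bullet> Y' + E \<bullet> (X ** transpose A) - Y \<bullet> (X ** transpose A)
      - (X ** transpose C) \<bullet> (X ** transpose A)
      - \<omega> * (Z \<bullet> A + Z \<bullet> transpose A + C \<bullet> A + C \<bullet> transpose A + transpose C \<bullet> A + transpose C \<bullet> transpose A)"
    by (simp add: ip_omega_def s inner_add_left inner_add_right inner_diff_left algebra_simps)
  also have "\<dots> = (transpose E ** X) \<bullet> A - (C ** (transpose X ** X)) \<bullet> A - \<omega> * (2 * (Z \<bullet> A) + 2 * (C \<bullet> A))"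
    by (simp add: perp[OF Y'] off[OF C(1) Y'(2)] EA YA CA cross cross' CtAt ZAt)
  also have "\<dots> = 0" using key by (simp add: algebra_simps)
  finally show ?thesis .
qed

definition grad_off_diagonal :: "(real^'n^'m) \<times> (real^'n^'n) \<Rightarrow> real^'n^'n" where
  "grad_off_diagonal p =
     snd p ** transpose (pgrad (fst p)) ** fst p ** matrix_inv (M_mat \<omega> (fst p))"

definition Mh_grad :: "(real^'n^'m) \<times> (real^'n^'n) \<Rightarrow> (real^'n^'m) \<times> (real^'n^'n)" where
  "Mh_grad p = (pgrad (fst p) ** (mat 1 - snd p) + fst p ** transpose (grad_off_diagonal p),
     - (grad_off_diagonal p + transpose (grad_off_diagonal p)))"

lemma grad_off_diagonal:
  assumes G: "G ** G = G" and X: "X ** G = 0"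
  shows "G ** grad_off_diagonal (X, G) = grad_off_diagonal (X, G)"
    and "grad_off_diagonal (X, G) ** G = 0"
    and "grad_off_diagonal (X, G) ** M_mat \<omega> X = G ** transpose (pgrad X) ** X"
  by (simp_all add: grad_off_diagonal_def mat_simps mult_chain[OF G] M_mat_kernel[OF \<omega> X] X
      M_mat_inv[OF \<omega>])

text \<open>
  Projecting \<open>(\<nabla>f, 0)\<close> gives the off-diagonal part \<open>G(\<nabla>f)\<^sup>TXM\<^sup>-\<^sup>1\<close>; as \<open>\<nabla>f\<close> and \<open>\<gamma>\<close> agree after
  multiplication with \<open>G\<close>, the gradient depends on \<open>\<gamma>\<close> only.
\<close>

lemma riem_grad_Mh:
  assumes p: "(X, G) \<in> Mh TYPE('r::finite) h"
  shows "riem_grad (ip_omega \<omega>) (Mh TYPE('r) h) (f \<circ> fst) (X, G) = Mh_grad (X, G)"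
proof -
  note G = Mh_D(1,2)[OF p] and X = Mh_D(3,4)[OF p]
  note T = tangent_space_Mh[OF p]
  let ?B = "grad_off_diagonal (X, G)" and ?Y = "pgrad X ** (mat 1 - G)"
  note B = grad_off_diagonal[OF G(2) X(1)]
  have fd: "f differentiable at X" using f2 by (simp add: numeral_2_eq_2)
  have Y: "J X ?Y = 0" "?Y ** G = 0"
    using projected_grad(1)[OF J surj[OF X(2)]] J_kernel[OF G X(1)]
    by (simp_all add: mat_simps J_simps G)
  show ?thesis
  proof (rule riem_grad_eqI[OF definite_form_ip_omega[OF \<omega>]])
    show "subspace (tangent_space (Mh TYPE('r) h) (X, G))" unfolding T by (rule subspace_Mh_tangent)
    have "(fst has_derivative fst) (at (X, G))"
      by (intro bounded_linear_imp_has_derivative bounded_linear_fst)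
    from diff_chain_at[OF this, of f] has_derivative_egrad(2)[OF fd]
    show "((f \<circ> fst) has_derivative (\<lambda>u. egrad f X \<bullet> fst u)) (at (X, G))"
      by (simp add: o_def)
    show "Mh_grad (X, G) \<in> tangent_space (Mh TYPE('r) h) (X, G)"
      unfolding T Mh_tangent_def Mh_grad_def using Y B by auto
    fix v assume v: "v \<in> tangent_space (Mh TYPE('r) h) (X, G)"
    have "ip_omega \<omega> ((egrad f X, 0) - Mh_grad (X, G)) v = 0"
      unfolding Mh_grad_def fst_conv snd_conv
    proof (rule ip_omega_residual[OF G X(1) _ Y B(1,2) _ _ v[unfolded T]])
      show "transpose 0 = (0 :: real^'n^'n)" by (simp add: transpose_linear)
      fix Y' assume Y': "J X Y' = 0" "Y' ** G = 0"
      have "(pgrad X ** G) \<bullet> Y' = 0" by (simp only: inner_mult_right G Y' inner_zero_right)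
      then show "(egrad f X - ?Y) \<bullet> Y' = 0"
        using projected_grad(2)[OF J surj[OF X(2)] Y'(1), of f]
        by (simp add: mult_distrib inner_diff_left)
    next
      have "transpose (egrad f X ** G) = transpose (pgrad X ** G)"
        by (simp only: normal_part_kernel[OF G X])
      then have "G ** transpose (egrad f X) = G ** transpose (pgrad X)" by (simp only: matrix_transpose_mul G)
      then have "G ** (transpose (egrad f X) ** X) = G ** (transpose (pgrad X) ** X)"
        by (metis matrix_mul_assoc)
      then show "?B ** M_mat \<omega> X = G ** (transpose (egrad f X) ** X - (2 * \<omega>) *\<^sub>R 0) ** (mat 1 - G)"
        unfolding B(3) by (simp add: mat_simps X)
    qed
    then show "egrad f X \<bullet> fst v = ip_omega \<omega> (Mh_grad (X, G)) v"
      by (simp add: ip_omega_def inner_diff_left algebra_simps)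
  qed
qed

section \<open>The Hessian on the decoupled manifold\<close>

text \<open>
  The derivative of the gradient field along a curve contains an unknown derivative \<open>B'\<close> of its
  off-diagonal part. Projection only needs \<open>GB'M\<Pi>\<close> and \<open>\<Pi>B'\<close>; the former follows by differentiating
  \<open>BM = G\<gamma>\<^sup>TX\<close>, the latter from \<open>B = GB\<close>. The result is the same for all curves with the given
  velocity.
\<close>

lemma riem_hess_Mh:
  assumes p: "(X, G) \<in> Mh TYPE('r::finite) h"
    and tangent: "(\<eta>, \<zeta>) \<in> Mh_tangent h X G"
  defines "\<gamma>' \<equiv> frechet_derivative pgrad (at X) \<eta>" and "B \<equiv> grad_off_diagonal (X, G)"
  assumes Y: "J X Y = 0" "Y ** G = 0" and C: "G ** C = C" "C ** G = 0"
    and perp: "\<And>Y'. J X Y' = 0 \<Longrightarrow> Y' ** G = 0 \<Longrightarrow>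
      (\<gamma>' - pgrad X ** \<zeta> ** (mat 1 - G) + X ** transpose B ** \<zeta> - Y) \<bullet> Y' = 0"
    and CM: "C ** M_mat \<omega> X = G ** transpose \<gamma>' ** X +
      (G ** transpose (pgrad X) - B ** transpose X) ** \<eta> ** (mat 1 - G)"
  shows "riem_hess (ip_omega \<omega>) (Mh TYPE('r) h) (f \<circ> fst) (X, G) (\<eta>, \<zeta>) =
    (Y + X ** transpose C, - (C + transpose C))"
proof (rule riem_hess_eqI)
  note G = Mh_D(1,2)[OF p] and X = Mh_D(3,4)[OF p]
  note T = tangent_space_Mh[OF p]
  note B = grad_off_diagonal[OF G(2) X(1), folded B_def]
  show "(\<eta>, \<zeta>) \<in> tangent_space (Mh TYPE('r) h) (X, G)" unfolding T by (rule tangent)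
  obtain Y0 A where "\<eta> = Y0 + X ** transpose A" and \<zeta>A: "\<zeta> = - (A + transpose A)"
    and A: "G ** A = A" "A ** G = 0"
    using tangent unfolding Mh_tangent_def by blast
  have At: "transpose A ** G = transpose A" "G ** transpose A = 0"
    using arg_cong[OF A(1), of transpose] arg_cong[OF A(2), of transpose]
    by (simp_all add: matrix_transpose_mul G transpose_linear)
  have \<zeta>t: "transpose \<zeta> = \<zeta>" by (simp add: \<zeta>A transpose_linear add.commute)
  have G\<zeta>G: "G ** (\<zeta> ** G) = 0" by (simp add: \<zeta>A mat_simps A At)
  have \<zeta>: "\<zeta> ** G + G ** \<zeta> = \<zeta>" by (simp add: \<zeta>A mat_simps A At)
  fix c assume c: "curve_through (Mh TYPE('r) h) (X, G) (\<eta>, \<zeta>) c"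
  obtain e where e: "e > 0" "\<And>t. \<bar>t\<bar> < e \<Longrightarrow> c t \<in> Mh TYPE('r) h"
    using c curve_through_eventually by blast
  have c0: "c 0 = (X, G)" and cv: "(c has_vector_derivative (\<eta>, \<zeta>)) (at 0)"
    using c unfolding curve_through_def by auto
  define x where "x t = fst (c t)" for t
  define g where "g t = snd (c t)" for t
  have c_eq: "c t = (x t, g t)" for t by (simp add: x_def g_def)
  have x0: "x 0 = X" "g 0 = G" by (simp_all add: x_def g_def c0)
  have dx: "(x has_vector_derivative \<eta>) (at 0)" and dg: "(g has_vector_derivative \<zeta>) (at 0)"
    using bounded_linear.has_vector_derivative[OF bounded_linear_fst cv]
      bounded_linear.has_vector_derivative[OF bounded_linear_snd cv]
    by (simp_all add: x_def[abs_def] g_def[abs_def])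
  have dxt: "((\<lambda>t. transpose (x t)) has_vector_derivative transpose \<eta>) (at 0)"
    by (rule bounded_linear.has_vector_derivative[OF bounded_linear_transpose dx])
  have d\<gamma>: "((\<lambda>t. pgrad (x t)) has_vector_derivative \<gamma>') (at 0)"
  proof -
    have "(pgrad has_derivative frechet_derivative pgrad (at X)) (at X)"
      using differentiable_projected_grad[OF h2 f2 surj[OF X(2)]] by (simp add: frechet_derivative_works)
    then show ?thesis
      using vector_derivative_diff_chain_within[of x \<eta> 0 UNIV pgrad "frechet_derivative pgrad (at X)"] dx x0
      by (auto simp: o_def \<gamma>'_def intro: has_derivative_at_withinI)
  qed
  have d\<gamma>t: "((\<lambda>t. transpose (pgrad (x t))) has_vector_derivative transpose \<gamma>') (at 0)"
    by (rule bounded_linear.has_vector_derivative[OF bounded_linear_transpose d\<gamma>])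
  define b where "b t = grad_off_diagonal (x t, g t)" for t
  have b0: "b 0 = B" by (simp add: b_def x0 B_def)
  have dM: "((\<lambda>t. M_mat \<omega> (x t)) has_vector_derivative (transpose X ** \<eta> + transpose \<eta> ** X)) (at 0)"
    using has_vector_derivative_add[OF has_vector_derivative_const matmul.has_vector_derivative[OF dxt dx], of "(2 * \<omega>) *\<^sub>R mat 1"]
    by (simp add: M_mat_eq x0)
  have dgx: "((\<lambda>t. g t ** transpose (pgrad (x t)) ** x t) has_vector_derivative
      G ** transpose (pgrad X) ** \<eta> + (G ** transpose \<gamma>' + \<zeta> ** transpose (pgrad X)) ** X) (at 0)"
    using matmul.has_vector_derivative[OF matmul.has_vector_derivative[OF dg d\<gamma>t] dx] by (simp add: x0)
  obtain B' where dB: "(b has_vector_derivative B') (at 0)"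
  proof -
    have "(\<lambda>t. matrix_inv (M_mat \<omega> (x t))) differentiable at 0"
      using dM invertible_M_mat[OF \<omega>] by (intro differentiable_matrix_inv differentiableI_vector)
    then obtain N' where "((\<lambda>t. matrix_inv (M_mat \<omega> (x t))) has_vector_derivative N') (at 0)"
      using vector_derivative_works by blast
    from matmul.has_vector_derivative[OF dgx this] show thesis
      by (intro that) (simp add: b_def[abs_def] grad_off_diagonal_def)
  qed
  have dBt: "((\<lambda>t. transpose (b t)) has_vector_derivative transpose B') (at 0)"
    by (rule bounded_linear.has_vector_derivative[OF bounded_linear_transpose dB])
  have BM': "B ** (transpose X ** \<eta> + transpose \<eta> ** X) + B' ** M_mat \<omega> X =
      G ** transpose (pgrad X) ** \<eta> + (G ** transpose \<gamma>' + \<zeta> ** transpose (pgrad X)) ** X"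
  proof (rule vector_derivative_unique_at)
    show "((\<lambda>t. b t ** M_mat \<omega> (x t)) has_vector_derivative
        B ** (transpose X ** \<eta> + transpose \<eta> ** X) + B' ** M_mat \<omega> X) (at 0)"
      using matmul.has_vector_derivative[OF dB dM] by (simp add: x0 b0)
    show "((\<lambda>t. b t ** M_mat \<omega> (x t)) has_vector_derivative
      G ** transpose (pgrad X) ** \<eta> + (G ** transpose \<gamma>' + \<zeta> ** transpose (pgrad X)) ** X) (at 0)"
      using dgx by (simp add: b_def grad_off_diagonal_def matrix_mul_assoc[symmetric] M_mat_inv[OF \<omega>])
  qed
  \<comment> \<open>The equation \<open>B = GB\<close> rests on \<open>G\<^sup>2 = G\<close>, hence holds near time 0, where the curve lies in the
    manifold.\<close>
  have GB': "G ** B' + \<zeta> ** B = B'"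
  proof (rule vector_derivative_unique_at)
    show "((\<lambda>t. g t ** b t) has_vector_derivative G ** B' + \<zeta> ** B) (at 0)"
      using matmul.has_vector_derivative[OF dg dB] by (simp add: x0 b0)
    show "((\<lambda>t. g t ** b t) has_vector_derivative B') (at 0)"
    proof (rule has_vector_derivative_transform_within_open[OF dB, of "{-e<..<e}"])
      fix t assume "t \<in> {-e<..<e}"
      then have "(x t, g t) \<in> Mh TYPE('r) h" using e(2)[of t] by (simp add: c_eq abs_less_iff)
      from grad_off_diagonal(1)[OF Mh_D(2,3)[OF this]] show "b t = g t ** b t" by (simp add: b_def)
    qed (use e in auto)
  qed
  define D1 where "D1 = pgrad X ** (- \<zeta>) + \<gamma>' ** (mat 1 - G) + (X ** transpose B' + \<eta> ** transpose B)"
  define D2 where "D2 = - (B' + transpose B')"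
  have "((\<lambda>t. mat 1 - g t) has_vector_derivative - \<zeta>) (at 0)"
    using has_vector_derivative_diff[OF has_vector_derivative_const dg, of "mat 1"] by simp
  from matmul.has_vector_derivative[OF d\<gamma> this] matmul.has_vector_derivative[OF dx dBt]
  have "((\<lambda>t. (pgrad (x t) ** (mat 1 - g t) + x t ** transpose (b t), - (b t + transpose (b t))))
      has_vector_derivative (D1, D2)) (at 0)"
    unfolding D1_def D2_def
    by (intro has_vector_derivative_Pair has_vector_derivative_add has_vector_derivative_minus dB dBt)
      (simp_all add: x0 b0)
  then have dgrad: "((\<lambda>t. Mh_grad (c t)) has_vector_derivative (D1, D2)) (at 0)"
    by (simp add: Mh_grad_def c_eq b_def)
  have D: "((\<lambda>t. riem_grad (ip_omega \<omega>) (Mh TYPE('r) h) (f \<circ> fst) (c t)) has_vector_derivative (D1, D2)) (at 0)"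
  proof (rule has_vector_derivative_transform_within_open[OF dgrad, of "{-e<..<e}"])
    fix t assume "t \<in> {-e<..<e}"
    then have "(x t, g t) \<in> Mh TYPE('r) h" using e(2)[of t] by (simp add: c_eq abs_less_iff)
    then show "Mh_grad (c t) = riem_grad (ip_omega \<omega>) (Mh TYPE('r) h) (f \<circ> fst) (c t)"
      unfolding c_eq by (rule riem_grad_Mh[symmetric])
  qed (use e in auto)
  have tB: "transpose B ** G = transpose B" "G ** transpose B = 0"
    using arg_cong[OF B(1), of transpose] arg_cong[OF B(2), of transpose]
    by (simp_all add: matrix_transpose_mul G transpose_linear)
  have tGB': "transpose B' ** G + transpose B ** \<zeta> = transpose B'"
    using arg_cong[OF GB', of transpose] by (simp add: matrix_transpose_mul transpose_linear G \<zeta>t)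
  have "orth_proj (ip_omega \<omega>) (Mh_tangent h X G) (D1, D2) = (Y + X ** transpose C, - (C + transpose C))"
  proof (rule orth_proj_eqI[OF definite_form_ip_omega[OF \<omega>] subspace_Mh_tangent])
    show "(Y + X ** transpose C, - (C + transpose C)) \<in> Mh_tangent h X G"
      unfolding Mh_tangent_def using Y C by blast
    fix s assume s: "s \<in> Mh_tangent h X G"
    show "ip_omega \<omega> ((D1, D2) - (Y + X ** transpose C, - (C + transpose C))) s = 0"
    proof (rule ip_omega_residual[OF G X(1) _ Y C _ _ s])
      show "transpose D2 = D2" by (simp add: D2_def transpose_linear add.commute)
      fix Y' assume Y': "J X Y' = 0" "Y' ** G = 0"
      have kill: "(L ** G) \<bullet> Y' = 0" for L by (simp only: inner_mult_right G Y' inner_zero_right)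
      \<comment> \<open>Multiples of \<open>G\<close> on the right are orthogonal to \<open>Y'\<close>, so they can be split off.\<close>
      have "D1 = (\<gamma>' - pgrad X ** \<zeta> ** (mat 1 - G) + X ** transpose B ** \<zeta>)
          + (X ** transpose B' + \<eta> ** transpose B - \<gamma>' - pgrad X ** \<zeta>) ** G"
      proof -
        have "X ** transpose B' = X ** (transpose B' ** G) + X ** (transpose B ** \<zeta>)"
          using tGB' by (metis matmul.add_right)
        moreover have "transpose B ** (\<zeta> ** G) = transpose B ** (G ** (\<zeta> ** G))"
          by (simp add: mult_chain[OF tB(1)])
        ultimately show ?thesis by (simp add: D1_def mat_simps tB G G\<zeta>G algebra_simps)
      qed
      then show "(D1 - Y) \<bullet> Y' = 0"
        using perp[OF Y'] kill[of "X ** transpose B' + \<eta> ** transpose B - \<gamma>' - pgrad X ** \<zeta>"]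
        by (simp add: inner_add_left inner_diff_left)
    next
      have tD1: "transpose D1 = - (\<zeta> ** transpose (pgrad X)) + (mat 1 - G) ** transpose \<gamma>'
          + (B' ** transpose X + B ** transpose \<eta>)"
        by (simp add: D1_def matrix_transpose_mul transpose_linear G \<zeta>t mult_distrib)
      have 1: "G ** (transpose D1 ** X) = - (G ** (\<zeta> ** (transpose (pgrad X) ** X)))
          + G ** (B' ** (transpose X ** X)) + B ** (transpose \<eta> ** X)"
        by (simp add: tD1 mat_simps G mult_chain[OF G(2)] mult_chain[OF B(1)])
      have GtB': "G ** (transpose B' ** (mat 1 - G)) = 0"
      proof -
        have "transpose B' ** (mat 1 - G) = transpose B ** \<zeta>"
          using tGB' by (simp add: mult_distrib diff_eq_eq add.commute)
        then show ?thesis by (simp add: mult_chain[OF tB(2)] mult_distrib)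
      qed
      have "G ** (transpose D1 ** X - (2 * \<omega>) *\<^sub>R D2) ** (mat 1 - G)
         = G ** (transpose D1 ** X) + (2 * \<omega>) *\<^sub>R (G ** (B' ** (mat 1 - G)))"
        using GtB' by (simp add: D2_def mat_simps X G algebra_simps)
      \<comment> \<open>The two terms with \<open>B'\<close> combine, because \<open>X\<^sup>TX + 2\<omega>(I - G) = M(I - G)\<close>.\<close>
      also have "\<dots> = G ** (B' ** (M_mat \<omega> X ** (mat 1 - G)))
         - G ** (\<zeta> ** (transpose (pgrad X) ** X)) + B ** (transpose \<eta> ** X)"
        unfolding 1 by (simp add: M_mat_eq mat_simps X algebra_simps)
      also have "G ** (B' ** (M_mat \<omega> X ** (mat 1 - G))) =
         G ** (G ** transpose (pgrad X) ** \<eta> + (G ** transpose \<gamma>' + \<zeta> ** transpose (pgrad X)) ** X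
           - B ** (transpose X ** \<eta> + transpose \<eta> ** X)) ** (mat 1 - G)"
        unfolding BM'[symmetric] by (simp add: matrix_mul_assoc)
      finally show "C ** M_mat \<omega> X = G ** (transpose D1 ** X - (2 * \<omega>) *\<^sub>R D2) ** (mat 1 - G)"
        unfolding CM by (simp add: mat_simps X mult_chain[OF G(2)] mult_chain[OF B(1)] algebra_simps)
    qed
  qed
  with D show "\<exists>D. ((\<lambda>t. riem_grad (ip_omega \<omega>) (Mh TYPE('r) h) (f \<circ> fst) (c t)) has_vector_derivative D) (at 0) \<and>
      orth_proj (ip_omega \<omega>) (tangent_space (Mh TYPE('r) h) (X, G)) D = (Y + X ** transpose C, - (C + transpose C))"
    unfolding T by blast
qed

text \<open>
  Here \<open>Y = K\<^sub>bV\<^sup>T\<close> and \<open>C = V\<^sub>bV\<^sup>T\<close> are inserted into the frame-free description of the Hessian.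
  The weight \<open>W = I - HM\<^sub>H\<^sup>-\<^sup>1H\<^sup>T\<close> arises as \<open>I - XM\<^sup>-\<^sup>1X\<^sup>T\<close>, in the off-diagonal part from
  \<open>G\<gamma>\<^sup>T - BX\<^sup>T\<close> and in the other part from \<open>\<gamma>V\<^sub>p - XB\<^sup>TV\<^sub>p\<close>.
\<close>

lemma tangent_rep_riem_hess_Mh:
  fixes \<iota> :: "'r::finite \<Rightarrow> 'n" and H K :: "real^'r^'m" and V Vp :: "real^'r^'n"
  assumes inj: "inj \<iota>" and rep: "point_rep \<iota> h H V (X, G)" and p: "(X, G) \<in> Mh TYPE('r) h"
    and tan_rep: "tangent_rep \<iota> h H V K Vp (\<eta>, \<zeta>)"
    and tangent: "(\<eta>, \<zeta>) \<in> tangent_space (Mh TYPE('r) h) (X, G)"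
  shows "tangent_rep \<iota> h H V
     (riem_hess inner (level_set h) f X \<eta> ** V
        + orth_proj inner (tangent_space (level_set_r \<iota> h) H)
            (W_mat \<omega> H ** egrad f X ** Vp))
     (G ** (- (Vp ** transpose (orth_proj inner (normal_space_at (level_set_r \<iota> h) H)
                                   (egrad f X ** V)) ** H)
            + transpose (ehess f X \<eta>) ** H
            + transpose (egrad f X) ** W_mat \<omega> H ** K)
        ** matrix_inv (M_mat \<omega> H))
     (riem_hess (ip_omega \<omega>) (Mh TYPE('r) h) (f \<circ> fst) (X, G) (\<eta>, \<zeta>))"
proof -
  have Hin: "H \<in> level_set_r \<iota> h" and V: "transpose V ** V = mat 1"
    and XH: "X = H ** transpose V" and GV: "G = mat 1 - V ** transpose V"
    using rep by (auto simp: point_rep_def St_def)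
  have Kin: "K \<in> tangent_space (level_set_r \<iota> h) H" and Vp: "transpose V ** Vp = 0"
    and \<eta>: "\<eta> = K ** transpose V + H ** transpose Vp"
    and \<zeta>: "\<zeta> = - (Vp ** transpose V) - V ** transpose Vp"
    using tan_rep by (auto simp: tangent_rep_def)
  note G = Mh_D(1,2)[OF p] and X = Mh_D(3,4)[OF p]
  define T where "T = tangent_space (level_set_r \<iota> h) H"
  have T: "T = {K. J X (K ** transpose V) = 0}"
    unfolding T_def XH by (rule tangent_space_level_set_r[OF inj V Hin])
  have subT: "subspace T"
    unfolding T
    by (rule linear_subspace_kernel)
      (intro linear_compose[OF _ J_linear, unfolded o_def] bounded_linear.linear matmul.bounded_linear_left)
  have VG: "transpose V ** G = 0" and GV0: "G ** V = 0"
    by (simp_all add: GV mat_simps mult_chain[OF V] V)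
  have GVp: "G ** Vp = Vp" by (simp add: GV mat_simps Vp)
  have VpV: "transpose Vp ** V = 0"
    using arg_cong[OF Vp, of transpose] by (simp add: matrix_transpose_mul transpose_linear)
  have VpG: "transpose Vp ** G = transpose Vp"
    using arg_cong[OF GVp, of transpose] by (simp add: matrix_transpose_mul G)
  have VVt: "V ** transpose V = mat 1 - G" by (simp add: GV)
  have mult_V_in_T: "L ** V \<in> T" if "J X L = 0" for L
    unfolding T using that J_kernel[OF G X(1)]
    by (simp add: matrix_mul_assoc[symmetric] VVt mult_distrib J_simps)

  define \<gamma> where "\<gamma> = pgrad X"
  define \<gamma>' where "\<gamma>' = frechet_derivative pgrad (at X) \<eta>"
  define \<nu> where "\<nu> = egrad f X - \<gamma>"
  define Hs where "Hs = riem_hess inner (level_set h) f X \<eta>"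
  define Z where "Z = W_mat \<omega> H ** egrad f X ** Vp"
  define PZ where "PZ = orth_proj inner T Z"
  define Kb where "Kb = Hs ** V + PZ"
  define Vb where "Vb = G ** (- (Vp ** transpose (\<nu> ** V) ** H) + transpose (ehess f X \<eta>) ** H
            + transpose (egrad f X) ** W_mat \<omega> H ** K) ** matrix_inv (M_mat \<omega> H)"

  have J\<gamma>: "J X \<gamma> = 0" and \<nu>perp: "\<And>v. J X v = 0 \<Longrightarrow> \<nu> \<bullet> v = 0"
    unfolding \<gamma>_def \<nu>_def using projected_grad[OF J surj[OF X(2)]] by auto
  have gG: "egrad f X ** G = \<gamma> ** G" unfolding \<gamma>_def by (rule normal_part_kernel[OF G X])
  then have \<nu>G: "\<nu> ** G = 0" by (simp add: \<nu>_def mult_distrib)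

  have normal: "orth_proj inner (normal_space_at (level_set_r \<iota> h) H) (egrad f X ** V) = \<nu> ** V"
    unfolding normal_space_at_def T_def[symmetric]
  proof (rule orth_proj_eqI[OF definite_form_inner subspace_orthogonal_comp])
    have "L \<bullet> (\<nu> ** V) = 0" if "L \<in> T" for L
      using \<nu>perp[of "L ** transpose V"] that unfolding T
      by (simp add: inner_commute[of L] inner_mult_right)
    then show "\<nu> ** V \<in> orthogonal_comp T" by (simp add: orthogonal_comp_def orthogonal_def)
    fix s assume "s \<in> orthogonal_comp T"
    then have "(\<gamma> ** V) \<bullet> s = 0"
      using mult_V_in_T[OF J\<gamma>] by (simp add: orthogonal_comp_def orthogonal_def)
    then show "(egrad f X ** V - \<nu> ** V) \<bullet> s = 0" by (simp add: \<nu>_def mult_distrib)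
  qed

  have \<eta>T: "(\<eta>, \<zeta>) \<in> Mh_tangent h X G" using tangent tangent_space_Mh[OF p] by simp
  have J\<eta>: "J X \<eta> = 0"
  proof -
    have "K ** transpose V + H ** transpose Vp = K ** transpose V + (H ** transpose Vp) ** G"
      by (simp add: matrix_mul_assoc[symmetric] VpG)
    then show ?thesis
      using Kin J_kernel[OF G X(1), of "H ** transpose Vp"] unfolding T_def[symmetric] T \<eta>
      by (simp add: J_simps)
  qed
  let ?ker = "{v. J X v = 0}"
  have subker: "subspace ?ker" by (rule linear_subspace_kernel[OF J_linear])
  have Hs: "Hs = orth_proj inner ?ker \<gamma>'"
    unfolding Hs_def level_set_def \<gamma>'_def by (rule riem_hess_level_set[OF h2 f2 X(2) surj J\<eta>])
  have JHs: "J X Hs = 0" and Hsperp: "\<And>v. J X v = 0 \<Longrightarrow> (\<gamma>' - Hs) \<bullet> v = 0"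
    unfolding Hs using orth_proj_inner[OF subker] by auto
  have PZ: "PZ \<in> T" "\<And>s. s \<in> T \<Longrightarrow> (Z - PZ) \<bullet> s = 0"
    unfolding PZ_def using orth_proj_inner[OF subT] by auto
  have KbT: "Kb \<in> T" unfolding Kb_def by (intro subspace_add subT mult_V_in_T JHs PZ)
  have VVb: "transpose V ** Vb = 0" by (simp add: Vb_def mat_simps mult_chain[OF VG])

  have MV: "transpose V ** M_mat \<omega> X = M_mat \<omega> H ** transpose V"
    by (simp add: M_mat_eq XH mat_simps mult_chain[OF V])
  have invV: "matrix_inv (M_mat \<omega> H) ** transpose V = transpose V ** matrix_inv (M_mat \<omega> X)"
  proof -
    have "matrix_inv (M_mat \<omega> H) ** ((transpose V ** M_mat \<omega> X) ** matrix_inv (M_mat \<omega> X)) =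
        matrix_inv (M_mat \<omega> H) ** ((M_mat \<omega> H ** transpose V) ** matrix_inv (M_mat \<omega> X))"
      by (simp only: MV)
    then show ?thesis
      by (simp add: matrix_mul_assoc[symmetric] M_mat_inv[OF \<omega>] mult_chain[OF M_mat_inv(2)[OF \<omega>]])
  qed
  have invV': "V ** matrix_inv (M_mat \<omega> H) = matrix_inv (M_mat \<omega> X) ** V"
    using arg_cong[OF invV, of transpose] by (simp add: matrix_transpose_mul transpose_M_mat_inv[OF \<omega>])

  define B where "B = grad_off_diagonal (X, G)"
  have B: "B = G ** transpose \<gamma> ** X ** matrix_inv (M_mat \<omega> X)"
    by (simp add: B_def grad_off_diagonal_def \<gamma>_def)
  have Gg: "G ** transpose (egrad f X) = G ** transpose \<gamma>"
    using arg_cong[OF gG, of transpose] by (simp add: matrix_transpose_mul G)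
  have BX: "G ** transpose \<gamma> - B ** transpose X = G ** transpose (egrad f X) ** W_mat \<omega> H"
    unfolding Gg
    by (simp add: B W_mat_def mat_simps XH mult_chain[OF invV[symmetric, unfolded XH]] mult_chain[OF V])
  have gVp: "\<gamma> ** Vp = egrad f X ** Vp"
    using gG GVp by (metis matrix_mul_assoc)
  have tB: "transpose B = matrix_inv (M_mat \<omega> X) ** (transpose X ** (\<gamma> ** G))"
    by (simp add: B matrix_transpose_mul transpose_M_mat_inv[OF \<omega>] G matrix_mul_assoc)
  have XtB: "X ** transpose B ** Vp = H ** (matrix_inv (M_mat \<omega> H) ** (transpose H ** (egrad f X ** Vp)))"
  proof -
    have "X ** transpose B ** Vp = H ** ((transpose V ** matrix_inv (M_mat \<omega> X)) ** (V ** (transpose H ** (\<gamma> ** Vp))))"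
      by (simp add: tB XH mat_simps GVp)
    also have "\<dots> = H ** (matrix_inv (M_mat \<omega> H) ** (transpose H ** (\<gamma> ** Vp)))"
      unfolding invV[symmetric] by (simp add: mat_simps mult_chain[OF V])
    finally show ?thesis by (simp only: gVp)
  qed

  have "riem_hess (ip_omega \<omega>) (Mh TYPE('r) h) (f \<circ> fst) (X, G) (\<eta>, \<zeta>) =
      (Kb ** transpose V + X ** transpose (Vb ** transpose V),
        - (Vb ** transpose V + transpose (Vb ** transpose V)))"
  proof (rule riem_hess_Mh[OF p \<eta>T, folded \<gamma>_def \<gamma>'_def B_def])
    show "J X (Kb ** transpose V) = 0" using KbT unfolding T by simp
    show "Kb ** transpose V ** G = 0" by (simp add: mat_simps VG)
    show "G ** (Vb ** transpose V) = Vb ** transpose V"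
      by (simp add: Vb_def mat_simps mult_chain[OF G(2)])
    show "Vb ** transpose V ** G = 0" by (simp add: mat_simps VG)
  next
    fix Y' assume Y': "J X Y' = 0" "Y' ** G = 0"
    have \<zeta>G: "\<zeta> ** (mat 1 - G) = - (Vp ** transpose V)"
      by (simp add: \<zeta> mat_simps VG VpG)
    have tB\<zeta>: "transpose B ** \<zeta> = - (transpose B ** (Vp ** transpose V))"
      by (simp add: \<zeta> tB mat_simps mult_chain[OF GV0])
    have "- (\<gamma> ** \<zeta> ** (mat 1 - G)) + X ** transpose B ** \<zeta> = Z ** transpose V"
    proof -
      have pg: "\<gamma> ** \<zeta> ** (mat 1 - G) = - (\<gamma> ** Vp ** transpose V)"
        by (simp only: matrix_mul_assoc[symmetric] \<zeta>G matmul.minus_right)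
      have xb: "X ** transpose B ** \<zeta> = - (X ** transpose B ** Vp ** transpose V)"
        by (simp only: matrix_mul_assoc[symmetric] tB\<zeta> matmul.minus_right)
      have "- (\<gamma> ** \<zeta> ** (mat 1 - G)) + X ** transpose B ** \<zeta>
          = (\<gamma> ** Vp - X ** transpose B ** Vp) ** transpose V"
        by (simp only: pg xb matmul.diff_left minus_minus) simp
      also have "\<gamma> ** Vp - X ** transpose B ** Vp = Z"
        unfolding XtB gVp by (simp add: Z_def W_mat_def mat_simps)
      finally show ?thesis .
    qed
    then have split: "\<gamma>' - \<gamma> ** \<zeta> ** (mat 1 - G) + X ** transpose B ** \<zeta> - Kb ** transpose V
        = (\<gamma>' - Hs) + Hs ** G + (Z - PZ) ** transpose V"
      by (simp add: Kb_def mult_distrib matrix_mul_assoc[symmetric] VVt algebra_simps)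
    have "(Hs ** G) \<bullet> Y' = 0" by (simp only: inner_mult_right G Y' inner_zero_right)
    moreover have "((Z - PZ) ** transpose V) \<bullet> Y' = 0"
      using PZ(2)[OF mult_V_in_T[OF Y'(1)]] by (simp add: inner_mult_right)
    ultimately show "(\<gamma>' - \<gamma> ** \<zeta> ** (mat 1 - G) + X ** transpose B ** \<zeta> - Kb ** transpose V) \<bullet> Y' = 0"
      unfolding split using Hsperp[OF Y'(1)] by (simp add: inner_add_left)
  next
    \<comment> \<open>Differentiate \<open>(\<nabla>f - \<gamma>) G = 0\<close>, which holds on the whole manifold.\<close>
    have \<gamma>'G: "\<gamma>' ** G = ehess f X \<eta> ** G + \<nu> ** \<zeta>"
    proof -
      obtain c where c: "curve_through (Mh TYPE('r) h) (X, G) (\<eta>, \<zeta>) c"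
        using tangent unfolding tangent_space_def by blast
      have dg: "(egrad f has_derivative frechet_derivative (egrad f) (at X)) (at X)"
        using differentiable_egrad[OF f2] by (simp add: frechet_derivative_works)
      have dp: "(pgrad has_derivative frechet_derivative pgrad (at X)) (at X)"
        using differentiable_projected_grad[OF h2 f2 surj[OF X(2)]] by (simp add: frechet_derivative_works)
      have d1: "(fst has_derivative fst) (at (X, G))" and d2: "(snd has_derivative snd) (at (X, G))"
        by (auto intro!: bounded_linear_imp_has_derivative bounded_linear_fst bounded_linear_snd)
      have dd: "((\<lambda>p. egrad f (fst p) - pgrad (fst p)) has_derivative
          (\<lambda>u. ehess f X (fst u) - frechet_derivative pgrad (at X) (fst u))) (at (X, G))"
        using has_derivative_diff[OF diff_chain_at[OF d1, of "egrad f"] diff_chain_at[OF d1, of pgrad]] dg dp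
        by (simp add: o_def ehess_def)
      have "\<nu> ** snd (\<eta>, \<zeta>) + (ehess f X (fst (\<eta>, \<zeta>)) - frechet_derivative pgrad (at X) (fst (\<eta>, \<zeta>))) ** G = 0"
      proof (rule curve_through_derivative_zero[OF c, of "\<lambda>p. (egrad f (fst p) - pgrad (fst p)) ** snd p"])
        show "((\<lambda>p. (egrad f (fst p) - pgrad (fst p)) ** snd p) has_derivative
          (\<lambda>u. \<nu> ** snd u + (ehess f X (fst u) - frechet_derivative pgrad (at X) (fst u)) ** G)) (at (X, G))"
          using matmul.FDERIV[OF dd d2] by (simp add: \<nu>_def \<gamma>_def)
        fix y assume "y \<in> Mh TYPE('r) h"
        then have "(fst y, snd y) \<in> Mh TYPE('r) h" by simp
        from normal_part_kernel[OF Mh_D[OF this]]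
        show "(egrad f (fst y) - pgrad (fst y)) ** snd y = 0" by (simp add: mult_distrib)
      qed
      then show ?thesis by (simp add: \<gamma>'_def mult_distrib algebra_simps)
    qed
    have Vp\<nu>: "transpose Vp ** transpose \<nu> = 0"
    proof -
      have "\<nu> ** Vp = 0" using \<nu>G GVp by (metis matrix_mul_assoc matmul.zero_left)
      from arg_cong[OF this, of transpose] show ?thesis by (simp add: matrix_transpose_mul transpose_linear)
    qed
    have "transpose (\<nu> ** \<zeta>) = - (Vp ** (transpose V ** transpose \<nu>))"
      by (simp add: \<zeta> mat_simps Vp\<nu>)
    then have tG\<gamma>': "G ** transpose \<gamma>' = G ** transpose (ehess f X \<eta>) - Vp ** (transpose V ** transpose \<nu>)"
      using arg_cong[OF \<gamma>'G, of transpose] by (simp add: matrix_transpose_mul transpose_linear G)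
    have \<eta>V: "\<eta> ** (mat 1 - G) = K ** transpose V"
      by (simp add: \<eta> mat_simps VG VpG)
    have "Vb ** transpose V ** M_mat \<omega> X = G ** (- (Vp ** transpose (\<nu> ** V) ** H) + transpose (ehess f X \<eta>) ** H
            + transpose (egrad f X) ** W_mat \<omega> H ** K) ** transpose V"
      by (simp add: Vb_def matrix_mul_assoc[symmetric] MV mult_chain[OF M_mat_inv(2)[OF \<omega>]])
    also have "\<dots> = (G ** transpose (ehess f X \<eta>) - Vp ** (transpose V ** transpose \<nu>)) ** (H ** transpose V)
        + (G ** transpose (egrad f X) ** W_mat \<omega> H) ** (K ** transpose V)"
      by (simp add: mat_simps mult_chain[OF GVp] algebra_simps)
    also have "\<dots> = G ** transpose \<gamma>' ** X + (G ** transpose \<gamma> - B ** transpose X) ** \<eta> ** (mat 1 - G)"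
      unfolding tG\<gamma>'[symmetric] BX[symmetric] by (simp only: XH \<eta>V[symmetric] matrix_mul_assoc)
    finally show "Vb ** transpose V ** M_mat \<omega> X =
      G ** transpose \<gamma>' ** X + (G ** transpose \<gamma> - B ** transpose X) ** \<eta> ** (mat 1 - G)" .
  qed
  also have "\<dots> = (Kb ** transpose V + H ** transpose Vb, - (Vb ** transpose V) - V ** transpose Vb)"
    by (simp add: XH mat_simps mult_chain[OF V])
  finally have "tangent_rep \<iota> h H V Kb Vb (riem_hess (ip_omega \<omega>) (Mh TYPE('r) h) (f \<circ> fst) (X, G) (\<eta>, \<zeta>))"
    unfolding tangent_rep_def T_def[symmetric] using KbT VVb by blast
  then show ?thesis
    unfolding Kb_def Vb_def Hs_def PZ_def Z_def normal T_def .
qed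

end

theorem proposition9:
  fixes h :: "real^'n^'m \<Rightarrow> real^'q"
    and \<iota> :: "'r::finite \<Rightarrow> 'n"
    and f :: "real^'n^'m \<Rightarrow> real"
    and X \<eta> :: "real^'n^'m" and G \<zeta> :: "real^'n^'n"
    and H K :: "real^'r^'m" and V Vp :: "real^'r^'n"
    and \<omega> :: real
  assumes r_le: "CARD('r) \<le> min (CARD('m)) (CARD('n))"
    and inj: "inj \<iota>"
    and h_smooth: "smooth h"
    and h_inv: "orth_invariant h"
    and h_rank: "\<forall>Y\<in>level_set h. dim (range (frechet_derivative h (at Y))) = CARD('q)"
    and \<omega>_pos: "\<omega> > 0"
    and f_C2: "Ck 2 f"
    and point: "(X, G) \<in> Mh TYPE('r) h"
    and tangent: "(\<eta>, \<zeta>) \<in> tangent_space (Mh TYPE('r) h) (X, G)"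
    and rep: "point_rep \<iota> h H V (X, G)"
    and tan_rep: "tangent_rep \<iota> h H V K Vp (\<eta>, \<zeta>)"
  shows "tangent_rep \<iota> h H V
     (riem_hess inner (level_set h) f X \<eta> ** V
        + orth_proj inner (tangent_space (level_set_r \<iota> h) H)
            (W_mat \<omega> H ** egrad f X ** Vp))
     (G ** (- (Vp ** transpose (orth_proj inner (normal_space_at (level_set_r \<iota> h) H)
                                   (egrad f X ** V)) ** H)
            + transpose (ehess f X \<eta>) ** H
            + transpose (egrad f X) ** W_mat \<omega> H ** K)
        ** matrix_inv (M_mat \<omega> H))
     (riem_hess (ip_omega \<omega>) (Mh TYPE('r) h) (f \<circ> fst) (X, G) (\<eta>, \<zeta>))"
proof -
  have h2: "Ck 2 h" using h_smooth by (simp add: smooth_def)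
  interpret invariant_problem h f \<omega>
  proof
    fix Y assume "h Y = 0"
    then have d: "dim (range (frechet_derivative h (at Y))) = CARD('q)"
      using h_rank by (simp add: level_set_def)
    have "h differentiable (at Y)" using h2 by (simp add: numeral_2_eq_2)
    then have "subspace (range (frechet_derivative h (at Y)))"
      by (intro linear_subspace_image linear_frechet_derivative subspace_UNIV)
    then show "surj (frechet_derivative h (at Y))"
      using d subspace_dim_equal[of "range (frechet_derivative h (at Y))" UNIV] by simp
  qed (fact h2 f_C2 h_inv \<omega>_pos)+
  show ?thesis by (rule tangent_rep_riem_hess_Mh[OF inj rep point tan_rep tangent])
qed

end
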